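(* For every integer $d\geq 2$, for the Constrained-degree percolation model on the regular $d$-ary tree $\mathbb{T}_d$ with degree restriction $k_v=3$ for all vertices $v$ of $\mathbb{T}_d$, the critical time satisfies $t_c(\mathbb{T}_d,(3))<1$.
   Context: Regular $d$-ary tree. Let $[d]=\{1,\dots,d\}$ and $[d]_\star=\bigcup_{0\le n<\infty}[d]^n$, where $[d]^0$ consists of a single point $o$, the root. For $x=(x_1,\dots,x_n)\in[d]^n$ and $a\in[d]$ let $x\cdot a=(x_1,\dots,x_n,a)$. Then $\mathbb{T}_d$ is the graph with vertex set $[d]_\star$ and edge set $\{\langle x,x\cdot a\rangle: x\in[d]_\star,\ a\in[d]\}$. The origin $0$ is the root $o$. Constrained-degree percolation model. Let $G=(\mathbb{V},\mathbb{E})$ be an infinite connected graph of bounded degree with a distinguished vertex $0$ (the origin), and let $\kappa=(k_v)_{v\in\mathbb{V}}$ be integers (the degree restrictions). Let $U=(U_e)_{e\in\mathbb{E}}$ be i.i.d. random variables uniform on $[0,1]$, i.e. the coordinates on $[0,1]^{\mathbb{E}}$ with the cylinder $\sigma$-algebra and the product $P$ of Lebesgue measures. At time $0$ all edges are closed. Each edge $e=\langle u_1,u_2\rangle$ tries to open at time $U_e$; it succeeds, and then remains open forever, if and only if just before that time each endpoint $u_i$ ($i=1,2$) has strictly fewer than $k_{u_i}$ open incident edges; otherwise it stays closed forever. Formally, the configuration $\omega_t=\omega_t^{G,\kappa}(U)\in\{0,1\}^{\mathbb{E}}$ at time $t\in[0,1]$ is the ($P$-a.s. well-defined) one such that for $e=\langle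 u_1,u_2\rangle$, $$\omega_{t,e}=\mathbf 1\{U_e<t\}\prod_{i=1}^{2}\mathbf 1\bigl\{\#\{v\in\mathbb{V}\setminus\{u_{3-i}\}: \langle u_i,v\rangle\in\mathbb{E},\ \omega_{U_e,\langle u_i,v\rangle}=1\}<k_{u_i}\bigr\}.$$ The event $\{0\leftrightarrow\infty\text{ at }t\}$ is that infinitely many vertices are connected to the origin by paths of edges open in $\omega_t$ (i.e. with $\omega_{t,e}=1$). Set $\theta^{G,\kappa}(t)=P\{0\leftrightarrow\infty\text{ at }t\}$ and define the critical time $t_c(G,\kappa)=\sup\{t\in[0,1]:\theta^{G,\kappa}(t)=0\}$. For an integer $k$, $(k)$ denotes the constant restriction $k_v=k$ for all $v$; a restriction exceeding the degree of a vertex (as at the root when $d=2$) is simply not binding. *)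

theory Defs
  imports "HOL-Probability.Probability"
begin

type_synonym 'v edge = "'v set"

text \<open>
  A graph is given by its vertex set \<open>V\<close> and its set \<open>E\<close> of edges, an edge being the
  two-element set of its endpoints. A configuration in \<open>{0,1}\<^sup>E\<close> is identified with its
  set of open edges.
\<close>

definition clock_measure :: "'v edge set \<Rightarrow> ('v edge \<Rightarrow> real) measure" where
  "clock_measure E = (\<Pi>\<^sub>M e\<in>E. restrict_space lborel {0..1})"

text \<open>
  The defining equation of the constrained-degree process. For an endpoint \<open>u\<close> of \<open>e\<close>, the
  set \<open>e - {u}\<close> consists of the other endpoint of \<open>e\<close>.
\<close>

definition is_cdp_process ::
  "'v set \<Rightarrow> 'v edge set \<Rightarrow> ('v \<Rightarrow> int) \<Rightarrow> ('v edge \<Rightarrow> real) \<Rightarrow> (real \<Rightarrow> 'v edge set) \<Rightarrow> bool" where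
  "is_cdp_process V E k U \<omega> \<longleftrightarrow>
     \<omega> \<in> {0..1} \<rightarrow>\<^sub>E Pow E \<and>
     (\<forall>t\<in>{0..1}. \<forall>e\<in>E. e \<in> \<omega> t \<longleftrightarrow>
        U e < t \<and>
        (\<forall>u\<in>e. int (card {v \<in> V - (e - {u}). {u, v} \<in> E \<and> {u, v} \<in> \<omega> (U e)}) < k u))"

text \<open>
  On a graph of bounded degree, exactly one process satisfies the equation for almost every \<open>U\<close>;
  on the exceptional null set the value below is unspecified.
\<close>

definition cdp_config ::
  "'v set \<Rightarrow> 'v edge set \<Rightarrow> ('v \<Rightarrow> int) \<Rightarrow> ('v edge \<Rightarrow> real) \<Rightarrow> real \<Rightarrow> 'v edge set" where
  "cdp_config V E k U = (THE \<omega>. is_cdp_process V E k U \<omega>)"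

definition open_cluster :: "'v set \<Rightarrow> 'v edge set \<Rightarrow> 'v \<Rightarrow> 'v set" where
  "open_cluster V F x = {y \<in> V. (x, y) \<in> {(u, v). {u, v} \<in> F}\<^sup>*}"

text \<open>
  The completion makes the probability independent of the unspecified values of
  \<^const>\<open>cdp_config\<close> on the exceptional null set, which could otherwise spoil the
  measurability of the percolation event.
\<close>

definition percolation_prob ::
  "'v set \<Rightarrow> 'v edge set \<Rightarrow> 'v \<Rightarrow> ('v \<Rightarrow> int) \<Rightarrow> real \<Rightarrow> real" where
  "percolation_prob V E orig k t =
     measure (completion (clock_measure E))
       {U \<in> space (clock_measure E). infinite (open_cluster V (cdp_config V E k U t) orig)}"

definition critical_time :: "'v set \<Rightarrow> 'v edge set \<Rightarrow> 'v \<Rightarrow> ('v \<Rightarrow> int) \<Rightarrow> real" where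
  "critical_time V E orig k = Sup {t \<in> {0..1}. percolation_prob V E orig k t = 0}"

definition tree_vertices :: "nat \<Rightarrow> nat list set" where
  "tree_vertices d = lists {1..d}"

definition tree_edges :: "nat \<Rightarrow> nat list edge set" where
  "tree_edges d = {{x, x @ [a]} | x a. x \<in> tree_vertices d \<and> a \<in> {1..d}}"

end

theory Submission
  imports Defs
begin

text \<open>
  An edge whose clock rings at time \<open>u\<close> can be blocked from below only if its lower endpoint
  already has three open child edges at time \<open>u\<close>. Whether this happens depends on the subtree below
  the edge alone; call the edge effective if it does not. Among the effective child edges of any
  vertex, the first two always open, whatever the fate of the edge to the parent. So it suffices
  that the tree formed by the first two effective child edges of each vertex survives up to
  time \<open>t\<close>.

  Let \<open>Q s\<close> be the probability that an edge is effective and rings before \<open>s\<close>. A vertex is available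
  at time \<open>s\<close>, that is, has at most two effective child edges ringing before \<open>s\<close>, with probability at
  least \<open>1 - d Q s / 3\<close> by Markov's inequality, whence \<open>Q s \<ge> s (1 - d Q s / 3)\<close>. For
  \<open>t > 3/4\<close> this forces \<open>(1 - Q t)\<^sup>2 < (d choose 2) (Q t)\<^sup>2\<close>: two effective child edges are more likely
  than none. Conditioned on availability at time \<open>s \<le> t\<close>, a vertex has either at least three
  effective child edges before \<open>t\<close>, and then already the earliest one provides a critical offspring,
  or a binomial number of them conditioned to be at most two, whose mean exceeds one by the
  inequality above. Hence the survival probability conditioned on availability at time \<open>s\<close> is
  bounded below by the same \<open>\<delta> > 0\<close> for all \<open>s \<le> t\<close>.
\<close>

section \<open>Construction of the process\<close>

text \<open>The fate of \<open>e\<close> can depend only on edges that touch it and ring sooner.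
  Well-foundedness of this relation stands in for a global time order in the recursions on
  clocks.\<close>

definition earlier :: "'v edge set \<Rightarrow> ('v edge \<Rightarrow> real) \<Rightarrow> ('v edge \<times> 'v edge) set" where
  "earlier E U = {(f, e). f \<in> E \<and> e \<in> E \<and> f \<inter> e \<noteq> {} \<and> U f < U e}"

text \<open>What is decided is whether \<open>e\<close> succeeds at its own ringing time, so the
  time parameter of the process disappears. Cutting the recursion at depth \<open>n\<close> makes it
  total for every \<open>U\<close> and allows measurability to be proved by induction on
  \<open>n\<close>.\<close>

primrec opens_approx ::
  "'v set \<Rightarrow> 'v edge set \<Rightarrow> ('v \<Rightarrow> int) \<Rightarrow> ('v edge \<Rightarrow> real) \<Rightarrow> nat \<Rightarrow> 'v edge \<Rightarrow> bool" where
  "opens_approx V E k U 0 e \<longleftrightarrow> False"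
| "opens_approx V E k U (Suc n) e \<longleftrightarrow> (\<forall>u\<in>e.
     int (card {v \<in> V - (e - {u}). {u, v} \<in> E \<and> U {u, v} < U e \<and> opens_approx V E k U n {u, v}}) < k u)"

definition opens :: "'v set \<Rightarrow> 'v edge set \<Rightarrow> ('v \<Rightarrow> int) \<Rightarrow> ('v edge \<Rightarrow> real) \<Rightarrow> 'v edge \<Rightarrow> bool" where
  "opens V E k U e \<longleftrightarrow> (\<exists>N. \<forall>n\<ge>N. opens_approx V E k U n e)"

text \<open>Well-founded induction: once the finitely many predecessors of \<open>e\<close> have all
  settled by depth \<open>M\<close>, \<open>e\<close> has settled by depth \<open>Suc M\<close>,
  since \<open>step\<close> makes its value depend only on theirs one level down.\<close>

lemma wf_finite_depth:
  assumes "wf R" and fin: "\<And>e. finite {f. (f, e) \<in> R}"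
    and step: "\<And>n m e. (\<And>f. (f, e) \<in> R \<Longrightarrow> P n f = P m f) \<Longrightarrow> P (Suc n) e = P (Suc m) e"
  shows "\<exists>N. \<forall>n\<ge>N. P n e = P N e"
  using \<open>wf R\<close>
proof (induction e)
  case (less e)
  then obtain N where N: "\<And>f n. (f, e) \<in> R \<Longrightarrow> n \<ge> N f \<Longrightarrow> P n f = P (N f) f"
    by metis
  define M where "M = Max (insert 0 (N ` {f. (f, e) \<in> R}))"
  have M: "N f \<le> M" if "(f, e) \<in> R" for f
    unfolding M_def using that fin[of e] by (intro Max_ge) auto
  have "P n e = P (Suc M) e" if n: "n \<ge> Suc M" for n
  proof -
    obtain m where m: "n = Suc m" "m \<ge> M" using n by (cases n) auto
    show ?thesis unfolding m(1)
      by (rule step) (metis M N m(2) le_trans)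
  qed
  then show ?case by blast
qed

text \<open>Past the depth at which \<open>e\<close> and all its predecessors have settled, one more
  unfolding of \<open>opens_approx\<close> is the fixed-point equation for the limit.\<close>

lemma opens_iff:
  assumes wf: "wf (earlier E U)" and fin: "\<And>e. e \<in> E \<Longrightarrow> finite {f \<in> E. f \<inter> e \<noteq> {}}"
    and e: "e \<in> E"
  shows "opens V E k U e \<longleftrightarrow> (\<forall>u\<in>e.
     int (card {v \<in> V - (e - {u}). {u, v} \<in> E \<and> U {u, v} < U e \<and> opens V E k U {u, v}}) < k u)"
proof -
  \<comment> \<open>The conjunct \<open>e \<in> E\<close> keeps the family constant off the edge
    set, where \<open>earlier\<close> does not control the recursion.\<close>
  let ?P = "\<lambda>n e. e \<in> E \<and> opens_approx V E k U n e"
  have fin': "finite {f. (f, e) \<in> earlier E U}" for e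
    by (cases "e \<in> E") (auto simp: earlier_def intro: finite_subset[OF _ fin[of e]])
  \<comment> \<open>Applied with \<open>Q\<close> another depth, this gives stabilisation; with
    \<open>Q\<close> the limit, it gives the equation.\<close>
  have step: "opens_approx V E k U (Suc n) e =
     (\<forall>u\<in>e. int (card {v \<in> V - (e - {u}). {u, v} \<in> E \<and> U {u, v} < U e \<and> Q {u, v}}) < k u)"
    if Q: "\<And>f. (f, e) \<in> earlier E U \<Longrightarrow> opens_approx V E k U n f = Q f" and e: "e \<in> E" for n e Q
  proof -
    have "{v \<in> V - (e - {u}). {u, v} \<in> E \<and> U {u, v} < U e \<and> opens_approx V E k U n {u, v}} =
        {v \<in> V - (e - {u}). {u, v} \<in> E \<and> U {u, v} < U e \<and> Q {u, v}}" if "u \<in> e" for u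
      using that e by (intro Collect_cong conj_cong refl Q) (auto simp: earlier_def)
    then show ?thesis by simp
  qed
  have ex: "\<exists>N. \<forall>n\<ge>N. ?P n e = ?P N e" for e
  proof (rule wf_finite_depth[OF wf fin'])
    fix n m e assume *: "\<And>f. (f, e) \<in> earlier E U \<Longrightarrow> ?P n f = ?P m f"
    show "?P (Suc n) e = ?P (Suc m) e"
    proof (cases "e \<in> E")
      case True
      have "opens_approx V E k U n f = opens_approx V E k U m f" if "(f, e) \<in> earlier E U" for f
        using *[OF that] that by (auto simp: earlier_def)
      from step[OF this True] show ?thesis by simp
    qed simp
  qed
  then obtain N where "\<And>e n. n \<ge> N e \<Longrightarrow> ?P n e = ?P (N e) e" by metis
  then have N: "opens_approx V E k U n e = opens V E k U e" if "e \<in> E" "n \<ge> N e" for e n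
    using that unfolding opens_def by (metis nle_le)
  define M where "M = Max (insert (N e) (N ` {f. (f, e) \<in> earlier E U}))"
  have M: "N f \<le> M" if "(f, e) \<in> earlier E U" for f
    unfolding M_def using that fin'[of e] by (intro Max_ge) auto
  have "N e \<le> M"
    unfolding M_def using fin'[of e] by (intro Max_ge) auto
  then have "opens V E k U e = opens_approx V E k U (Suc M) e" using N[OF e, of "Suc M"] by simp
  also have "\<dots> = (\<forall>u\<in>e.
     int (card {v \<in> V - (e - {u}). {u, v} \<in> E \<and> U {u, v} < U e \<and> opens V E k U {u, v}}) < k u)"
    by (rule step[OF _ e], rule N) (use M in \<open>auto simp: earlier_def\<close>)
  finally show ?thesis .
qed

text \<open>Existence and uniqueness of the process for well-founded clocks: an edge that succeeds
  is open exactly after its clock, and induction along \<open>earlier\<close> shows that the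
  defining equation leaves no other choice.\<close>

lemma cdp_config_eq:
  assumes wf: "wf (earlier E U)" and fin: "\<And>e. e \<in> E \<Longrightarrow> finite {f \<in> E. f \<inter> e \<noteq> {}}"
    and U: "\<And>e. e \<in> E \<Longrightarrow> U e \<in> {0..1}" and t: "t \<in> {0..1}"
  shows "cdp_config V E k U t = {e \<in> E. U e < t \<and> opens V E k U e}"
proof -
  \<comment> \<open>The restriction makes \<omega> \<open>undefined\<close> outside
    \<open>{0..1}\<close>, as the extensional function space in \<open>is_cdp_process\<close>
    demands.\<close>
  define \<omega> where "\<omega> = (\<lambda>t\<in>{0..1::real}. {e \<in> E. U e < t \<and> opens V E k U e})"
  have mem: "f \<in> \<omega> (U e) \<longleftrightarrow> f \<in> E \<and> U f < U e \<and> opens V E k U f" if "e \<in> E" for e f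
    using U[OF that] by (auto simp: \<omega>_def)
  have "is_cdp_process V E k U \<omega>"
    unfolding is_cdp_process_def
  proof (intro conjI ballI)
    show "\<omega> \<in> {0..1} \<rightarrow>\<^sub>E Pow E" by (auto simp: \<omega>_def)
    fix t :: real and e assume "t \<in> {0..1}" and e: "e \<in> E"
    have *: "{v \<in> V - (e - {u}). {u, v} \<in> E \<and> {u, v} \<in> \<omega> (U e)} =
        {v \<in> V - (e - {u}). {u, v} \<in> E \<and> U {u, v} < U e \<and> opens V E k U {u, v}}" for u
      using mem[OF e] by auto
    show "e \<in> \<omega> t \<longleftrightarrow> U e < t \<and>
        (\<forall>u\<in>e. int (card {v \<in> V - (e - {u}). {u, v} \<in> E \<and> {u, v} \<in> \<omega> (U e)}) < k u)"
      unfolding * using \<open>t \<in> {0..1}\<close> e opens_iff[OF wf fin e, of V k] by (simp add: \<omega>_def)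
  qed
  moreover have "\<omega>' = \<omega>" if \<omega>': "is_cdp_process V E k U \<omega>'" for \<omega>'
  proof -
    have eq: "\<And>t e. t \<in> {0..1} \<Longrightarrow> e \<in> E \<Longrightarrow> e \<in> \<omega>' t \<longleftrightarrow> U e < t \<and>
        (\<forall>u\<in>e. int (card {v \<in> V - (e - {u}). {u, v} \<in> E \<and> {u, v} \<in> \<omega>' (U e)}) < k u)"
      and ext: "\<omega>' \<in> {0..1} \<rightarrow>\<^sub>E Pow E"
      using \<omega>' by (auto simp: is_cdp_process_def)
    \<comment> \<open>All times are treated at once because the equation for \<open>e\<close> at
      time \<open>t\<close> consults its neighbours at the different time
      \<open>U e\<close>.\<close>
    have main: "\<forall>t\<in>{0..1}. e \<in> E \<longrightarrow> (e \<in> \<omega>' t \<longleftrightarrow> U e < t \<and> opens V E k U e)" for e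
      using wf
    proof (induction e)
      case (less e)
      show ?case
      proof (intro ballI impI)
        fix t :: real assume t: "t \<in> {0..1}" and e: "e \<in> E"
        have "{u, v} \<in> \<omega>' (U e) \<longleftrightarrow> U {u, v} < U e \<and> opens V E k U {u, v}"
          if "u \<in> e" "{u, v} \<in> E" for u v
        proof (cases "U {u, v} < U e")
          case True
          then have "({u, v}, e) \<in> earlier E U" using that e by (auto simp: earlier_def)
          from less.IH[OF this] U[OF e] that show ?thesis by blast
        next
          case False
          then show ?thesis using eq[OF U[OF e] that(2)] by blast
        qed
        then have "{v \<in> V - (e - {u}). {u, v} \<in> E \<and> {u, v} \<in> \<omega>' (U e)} =
          {v \<in> V - (e - {u}). {u, v} \<in> E \<and> U {u, v} < U e \<and> opens V E k U {u, v}}"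
          if "u \<in> e" for u
          using that by (intro Collect_cong conj_cong refl) auto
        then show "e \<in> \<omega>' t \<longleftrightarrow> U e < t \<and> opens V E k U e"
          using eq[OF t e] opens_iff[OF wf fin e, of V k] by simp
      qed
    qed
    have "\<omega>' t = \<omega> t" for t
    proof (cases "t \<in> {0..1}")
      case True
      then have "\<omega>' t \<subseteq> E" using ext by (auto simp: PiE_iff)
      with True main show ?thesis by (auto simp: \<omega>_def)
    next
      case False
      then show ?thesis using ext unfolding \<omega>_def by (auto simp: PiE_iff extensional_def)
    qed
    then show ?thesis by auto
  qed
  ultimately have "cdp_config V E k U = \<omega>"
    unfolding cdp_config_def by (rule the_equality)
  with t show ?thesis by (simp add: \<omega>_def)
qed

section \<open>Almost sure well-foundedness of the order of clocks\<close>

primrec chains :: "'v edge set \<Rightarrow> nat \<Rightarrow> 'v edge \<Rightarrow> 'v edge list set" where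
  "chains E 0 e = {[e]}"
| "chains E (Suc n) e = (\<Union>f\<in>{f \<in> E. f \<inter> e \<noteq> {}}. (#) e ` chains E n f)"

lemma finite_card_chains:
  assumes fin: "\<And>e. e \<in> E \<Longrightarrow> finite {f \<in> E. f \<inter> e \<noteq> {}}"
    and D: "\<And>e. e \<in> E \<Longrightarrow> card {f \<in> E. f \<inter> e \<noteq> {}} \<le> D"
  shows "e \<in> E \<Longrightarrow> finite (chains E n e) \<and> card (chains E n e) \<le> D ^ n"
proof (induction n arbitrary: e)
  case (Suc n)
  let ?A = "{f \<in> E. f \<inter> e \<noteq> {}}"
  have "card (chains E (Suc n) e) \<le> (\<Sum>f\<in>?A. card ((#) e ` chains E n f))"
    unfolding chains.simps by (rule card_UN_le[OF fin[OF Suc.prems]])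
  also have "\<dots> \<le> (\<Sum>f\<in>?A. D ^ n)"
    using Suc.IH by (intro sum_mono order_trans[OF card_image_le]) auto
  also have "\<dots> \<le> D ^ Suc n" using D[OF Suc.prems] by simp
  finally have "card (chains E (Suc n) e) \<le> D ^ Suc n" .
  moreover have "finite (chains E (Suc n) e)"
    unfolding chains.simps using Suc.IH fin[OF Suc.prems] by blast
  ultimately show ?case by (rule conjI[rotated])
qed simp

lemma chains_length: "es \<in> chains E n e \<Longrightarrow> length es = Suc n"
  by (induction n arbitrary: e es) auto

lemma chains_subset: "e \<in> E \<Longrightarrow> es \<in> chains E n e \<Longrightarrow> set es \<subseteq> E"
proof (induction n arbitrary: e es)
  case (Suc n)
  from Suc.prems obtain f es' where "f \<in> E" "es' \<in> chains E n f" "es = e # es'"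
    by auto
  with Suc.IH[of f es'] Suc.prems show ?case by simp
qed simp

lemma map_chain:
  assumes "\<And>i. (c (Suc i), c i) \<in> earlier E U"
  shows "map c [i..<i + Suc n] \<in> chains E n (c i)"
proof (induction n arbitrary: i)
  case (Suc n)
  have "map c [i..<i + Suc (Suc n)] = c i # map c [Suc i..<Suc i + Suc n]"
    by (subst upt_rec) simp
  moreover have "c (Suc i) \<in> {f \<in> E. f \<inter> c i \<noteq> {}}"
    using assms[of i] by (auto simp: earlier_def)
  ultimately show ?case using Suc[of "Suc i"] by (simp del: upt_Suc) blast
qed simp

abbreviation unit_clock :: "real measure" where
  "unit_clock \<equiv> restrict_space lborel {0..1}"

lemma prob_space_unit_clock: "prob_space unit_clock"
  by (rule prob_spaceI) (simp add: space_restrict_space emeasure_restrict_space)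

lemma emeasure_unit_clock_slice:
  assumes "K > 0"
  shows "emeasure unit_clock {u \<in> {0..1}. \<lfloor>real K * u\<rfloor> = j} \<le> ennreal (1 / real K)"
proof -
  have "{u \<in> {0..1}. \<lfloor>real K * u\<rfloor> = j} \<subseteq> {of_int j / K .. (of_int j + 1) / K}"
  proof
    fix u :: real assume "u \<in> {u \<in> {0..1}. \<lfloor>real K * u\<rfloor> = j}"
    then have "\<lfloor>real K * u\<rfloor> = j" by simp
    then have "of_int j \<le> K * u" "K * u \<le> of_int j + 1" by linarith+
    then show "u \<in> {of_int j / K .. (of_int j + 1) / K}"
      using assms by (simp add: field_simps)
  qed
  moreover have "emeasure unit_clock {u \<in> {0..1}. \<lfloor>real K * u\<rfloor> = j}
      = emeasure lborel {u \<in> {0..1}. \<lfloor>real K * u\<rfloor> = j}"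
    by (intro emeasure_restrict_space) auto
  moreover have "emeasure lborel {of_int j / K .. (of_int j + 1) / K} = ennreal (1 / real K)"
    using assms by (subst emeasure_lborel_Icc) (auto simp: divide_simps)
  ultimately show ?thesis
    using emeasure_mono[of _ "{of_int j / K .. (of_int j + 1) / real K}" lborel] by simp
qed

text \<open>A union bound: at most \<open>D ^ n\<close> chains of \<open>n + 1\<close> edges start
  at \<open>e\<close>, and distinct edges have independent clocks, each in the slice with
  probability at most \<open>1 / K\<close>. Chains may repeat edges, so distinctness is imposed to
  obtain the product.\<close>

lemma emeasure_slice_chains_le:
  assumes fin: "\<And>e. e \<in> E \<Longrightarrow> finite {f \<in> E. f \<inter> e \<noteq> {}}"
    and D: "\<And>e. e \<in> E \<Longrightarrow> card {f \<in> E. f \<inter> e \<noteq> {}} \<le> D"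
    and "K > 0" and e: "e \<in> E"
  shows "{U \<in> space (clock_measure E). \<exists>es\<in>chains E n e. distinct es \<and> (\<forall>f\<in>set es. \<lfloor>real K * U f\<rfloor> = j)}
      \<in> sets (clock_measure E)" (is "?X \<in> _")
    and "emeasure (clock_measure E)
      {U \<in> space (clock_measure E). \<exists>es\<in>chains E n e. distinct es \<and> (\<forall>f\<in>set es. \<lfloor>real K * U f\<rfloor> = j)}
     \<le> ennreal (real D ^ n * (1 / real K) ^ Suc n)"
proof -
  interpret product_prob_space "\<lambda>_. unit_clock" E
    by (intro product_prob_spaceI prob_space_unit_clock)
  let ?S = "{u \<in> {0..1}. \<lfloor>real K * u\<rfloor> = j}"
  let ?Y = "\<lambda>es. {U \<in> space (clock_measure E). \<forall>f\<in>set es. U f \<in> ?S}"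
  let ?C = "{es \<in> chains E n e. distinct es}"
  have S: "?S \<in> sets unit_clock"
    by (subst sets_restrict_space_iff) auto
  have finC: "finite ?C" using finite_card_chains[OF fin D e] by auto
  have sub: "set es \<subseteq> E" if "es \<in> ?C" for es
    using that chains_subset[OF e] by blast
  have U01: "U f \<in> {0..1}" if "U \<in> space (clock_measure E)" "f \<in> E" for U f
    using that by (auto simp: clock_measure_def space_PiM space_restrict_space PiE_iff)
  have X_eq: "?X = (\<Union>es\<in>?C. ?Y es)"
    using sub U01 by blast
  have Y: "?Y es \<in> sets (clock_measure E)" "emeasure (clock_measure E) (?Y es) \<le> ennreal ((1 / real K) ^ Suc n)"
    if "es \<in> ?C" for es
  proof -
    have "{U \<in> space (clock_measure E). U f \<in> ?S} \<in> sets (clock_measure E)" if "f \<in> set es" for f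
      unfolding clock_measure_def using S sub[OF \<open>es \<in> ?C\<close>] that
      by (intro measurable_sets_Collect[OF measurable_component_singleton])
         (auto simp: space_restrict_space cong: conj_cong)
    then show "?Y es \<in> sets (clock_measure E)"
      by (intro sets.sets_Collect_finite_All) auto
    have "emeasure (clock_measure E) (?Y es) = (\<Prod>f\<in>set es. emeasure unit_clock ?S)"
      unfolding clock_measure_def using sub[OF that] S by (intro emeasure_PiM_Collect) auto
    also have "\<dots> \<le> (\<Prod>f\<in>set es. ennreal (1 / real K))"
      using emeasure_unit_clock_slice[OF \<open>K > 0\<close>, of j] by (simp add: power_mono)
    also have "\<dots> = ennreal ((1 / real K) ^ Suc n)"
      using that chains_length[of es E n e] by (simp add: distinct_card ennreal_power del: power_Suc)
    finally show "emeasure (clock_measure E) (?Y es) \<le> ennreal ((1 / real K) ^ Suc n)" .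
  qed
  show "?X \<in> sets (clock_measure E)"
    unfolding X_eq using finC Y by (intro sets.finite_UN) auto
  have "emeasure (clock_measure E) ?X \<le> (\<Sum>es\<in>?C. emeasure (clock_measure E) (?Y es))"
    unfolding X_eq using finC Y by (intro emeasure_subadditive_finite) auto
  also have "\<dots> \<le> (\<Sum>es\<in>?C. ennreal ((1 / real K) ^ Suc n))"
    using Y by (intro sum_mono) auto
  also have "\<dots> = ennreal (real (card ?C) * (1 / real K) ^ Suc n)"
    by (simp add: ennreal_mult ennreal_of_nat_eq_real_of_nat del: power_Suc)
  also have "card ?C \<le> D ^ n"
    using finite_card_chains[OF fin D e, of n] card_mono[of "chains E n e" ?C] by fastforce
  then have "ennreal (real (card ?C) * (1 / real K) ^ Suc n) \<le> ennreal (real D ^ n * (1 / real K) ^ Suc n)"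
    by (intro ennreal_leI mult_right_mono) (simp_all flip: of_nat_power)
  finally show "emeasure (clock_measure E) ?X \<le> ennreal (real D ^ n * (1 / real K) ^ Suc n)" .
qed

text \<open>
  On an infinite path with decreasing clocks, the clocks eventually stay in one slice of length
  \<open>1/K\<close>. For \<open>K > 2 D\<close> a union bound over paths excludes this almost surely.
\<close>

lemma AE_wf_earlier:
  assumes E: "countable E"
    and fin: "\<And>e. e \<in> E \<Longrightarrow> finite {f \<in> E. f \<inter> e \<noteq> {}}"
    and D: "\<And>e. e \<in> E \<Longrightarrow> card {f \<in> E. f \<inter> e \<noteq> {}} \<le> D"
  shows "AE U in clock_measure E. wf (earlier E U)"
proof -
  \<comment> \<open>The ratio \<open>D / K\<close> is then at most one half, so the bounds decay
    geometrically; the summand 1 keeps \<open>K\<close> positive when \<open>D\<close> is 0.\<close>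
  define K where "K = 2 * D + 1"
  let ?X = "\<lambda>e j n U. \<exists>es\<in>chains E n e. distinct es \<and> (\<forall>f\<in>set es. \<lfloor>real K * U f\<rfloor> = j)"
  have "K > 0" by (simp add: K_def)
  have "AE U in clock_measure E. \<exists>n. \<not> ?X e j n U" if e: "e \<in> E" for e and j :: int
  proof -
    let ?S = "\<lambda>n. {U \<in> space (clock_measure E). ?X e j n U}"
    have S: "?S n \<in> sets (clock_measure E)"
      "emeasure (clock_measure E) (?S n) \<le> ennreal ((1/2) ^ n)" for n
    proof -
      show "?S n \<in> sets (clock_measure E)"
        by (rule emeasure_slice_chains_le(1)) (use fin D \<open>K > 0\<close> e in auto)
      have "emeasure (clock_measure E) (?S n) \<le> ennreal (real D ^ n * (1 / real K) ^ Suc n)"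
        by (rule emeasure_slice_chains_le(2)) (use fin D \<open>K > 0\<close> e in auto)
      also have "real D ^ n * (1 / real K) ^ Suc n = (1 / real K) * (D / K) ^ n"
        by (simp add: power_divide)
      also have "ennreal ((1 / real K) * (D / K) ^ n) \<le> ennreal (1 * (1/2) ^ n)"
        by (intro ennreal_leI mult_mono power_mono) (auto simp: K_def divide_simps)
      finally show "emeasure (clock_measure E) (?S n) \<le> ennreal ((1/2) ^ n)" by simp
    qed
    have "emeasure (clock_measure E) (\<Inter>n. ?S n) \<le> ennreal ((1/2) ^ n)" for n
      by (rule order_trans[OF emeasure_mono S(2)[of n]]) (use S(1) in auto)
    then have "emeasure (clock_measure E) (\<Inter>n. ?S n) \<le> 0"
      by (intro tendsto_lowerbound[of "\<lambda>n. ennreal ((1/2) ^ n)" _ sequentially])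
         (auto intro!: tendsto_ennrealI[of _ 0, simplified] LIMSEQ_power_zero)
    then have "(\<Inter>n. ?S n) \<in> null_sets (clock_measure E)"
      using S(1) by (intro null_setsI sets.countable_INT) auto
    then show ?thesis by (rule AE_I') auto
  qed
  then have "AE U in clock_measure E. \<forall>e\<in>E. \<forall>j. \<exists>n. \<not> ?X e j n U"
    using E by (simp add: AE_ball_countable AE_all_countable)
  then show ?thesis
    using AE_space
  proof eventually_elim
    case (elim U)
    have U0: "U e \<ge> 0" if "e \<in> E" for e
      using elim(2) that by (auto simp: clock_measure_def space_PiM space_restrict_space PiE_iff)
    show ?case
      unfolding wf_iff_no_infinite_down_chain
    proof
      assume "\<exists>c. \<forall>i. (c (Suc i), c i) \<in> earlier E U"
      then obtain c where c: "\<And>i. (c (Suc i), c i) \<in> earlier E U" by blast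
      have cE: "c i \<in> E" for i using c[of i] by (auto simp: earlier_def)
      have dec: "U (c (Suc i)) < U (c i)" for i using c[of i] by (auto simp: earlier_def)
      have strict: "U (c j) < U (c i)" if "i < j" for i j
        using that by (induction rule: less_Suc_induct) (use dec in auto)
      define g where "g i = nat \<lfloor>real K * U (c i)\<rfloor>" for i
      \<comment> \<open>Slice numbers are naturals that never increase along the chain, hence are
        constant from an index of minimal value on.\<close>
      obtain i0 where i0: "\<And>i. g i0 \<le> g i"
        using ex_has_least_nat[of "\<lambda>_. True" 0 g] by auto
      have const: "\<lfloor>real K * U (c i)\<rfloor> = int (g i0)" if "i \<ge> i0" for i
      proof -
        have "U (c i) \<le> U (c i0)" using strict[of i0 i] that by (cases "i = i0") auto
        then have "\<lfloor>real K * U (c i)\<rfloor> \<le> \<lfloor>real K * U (c i0)\<rfloor>"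
          by (intro floor_mono mult_left_mono) auto
        moreover have "0 \<le> \<lfloor>real K * U (c i)\<rfloor>" using U0[OF cE] by simp
        ultimately show ?thesis using i0[of i] unfolding g_def by arith
      qed
      obtain n where n: "\<not> ?X (c i0) (int (g i0)) n U" using elim(1) cE by blast
      have "inj c" using strict by (intro linorder_injI) (metis less_irrefl)
      then have "distinct (map c [i0..<i0 + Suc n])"
        by (simp add: distinct_map inj_on_subset[of c UNIV] del: upt_Suc)
      moreover have "\<forall>f\<in>set (map c [i0..<i0 + Suc n]). \<lfloor>real K * U f\<rfloor> = int (g i0)"
        using const by (auto simp del: upt_Suc)
      ultimately show False using n map_chain[of c, OF c] by blast
    qed
  qed
qed


section \<open>Measurability of the percolation event\<close>

lemma measurable_clock:
  assumes "e \<in> E"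
  shows "(\<lambda>U. U e) \<in> borel_measurable (clock_measure E)"
proof -
  have "(\<lambda>u. u) \<in> borel_measurable unit_clock"
    by (intro measurable_restrict_space1) simp
  from measurable_compose[OF measurable_component_singleton[OF assms] this]
  show ?thesis by (simp add: clock_measure_def)
qed

text \<open>The injection \<open>to_nat\<close> preserves cardinality, which reduces the claim to
  random sets of naturals.\<close>

lemma measurable_card_countable:
  fixes S :: "'a \<Rightarrow> 'v::countable set"
  assumes "\<And>v. Measurable.pred M (\<lambda>x. v \<in> S x)"
  shows "(\<lambda>x. card (S x)) \<in> measurable M (count_space UNIV)"
proof -
  have "card (S x) = card {n \<in> range (to_nat :: 'v \<Rightarrow> nat). from_nat n \<in> S x}" for x
  proof -
    have "{n \<in> range (to_nat :: 'v \<Rightarrow> nat). from_nat n \<in> S x} = to_nat ` S x" by auto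
    then show ?thesis by (simp add: card_image)
  qed
  moreover have "(\<lambda>x. card {n \<in> range (to_nat :: 'v \<Rightarrow> nat). from_nat n \<in> S x}) \<in> measurable M (count_space UNIV)"
    by (rule measurable_card) (use assms in \<open>simp add: pred_intros_logic\<close>)
  ultimately show ?thesis by simp
qed

lemma pred_opens_approx:
  fixes V :: "'v::countable set"
  shows "e \<in> E \<Longrightarrow> Measurable.pred (clock_measure E) (\<lambda>U. opens_approx V E k U n e)"
proof (induction n arbitrary: e)
  case (Suc n)
  have "Measurable.pred (clock_measure E) (\<lambda>U. {u, v} \<in> E \<and> U {u, v} < U e \<and> opens_approx V E k U n {u, v})"
    for u v
  proof (cases "{u, v} \<in> E")
    case True
    note [measurable] = Suc.IH[OF True] measurable_clock[OF True] measurable_clock[OF Suc.prems]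
    show ?thesis by measurable
  qed simp
  note [measurable] = this
  have card: "(\<lambda>U. card {v \<in> V - (e - {u}). {u, v} \<in> E \<and> U {u, v} < U e \<and> opens_approx V E k U n {u, v}})
      \<in> measurable (clock_measure E) (count_space UNIV)" for u
    unfolding mem_Collect_eq by (rule measurable_card_countable) simp
  have [measurable]: "Measurable.pred (clock_measure E) (\<lambda>U. int (card
      {v \<in> V - (e - {u}). {u, v} \<in> E \<and> U {u, v} < U e \<and> opens_approx V E k U n {u, v}}) < k u)" for u
    by (rule measurable_compose[OF card]) simp
  show ?case
    unfolding opens_approx.simps Ball_def by measurable
qed simp

text \<open>Connection in \<open>n\<close> steps is built by countable unions over the intermediate
  vertex, and a cluster is infinite if and only if its codes under \<open>to_nat\<close> are
  unbounded.\<close>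

lemma pred_infinite_open_cluster:
  fixes V :: "'v::countable set"
  shows "Measurable.pred (clock_measure E)
    (\<lambda>U. infinite (open_cluster V {e \<in> E. U e < t \<and> opens V E k U e} x))"
proof -
  let ?F = "\<lambda>U. {e \<in> E. U e < t \<and> opens V E k U e}"
  let ?R = "\<lambda>U. {(u, v). {u, v} \<in> ?F U}"
  have F: "Measurable.pred (clock_measure E) (\<lambda>U. {u, v} \<in> ?F U)" for u v
  proof (cases "{u, v} \<in> E")
    case True
    note [measurable] = pred_opens_approx[OF True] measurable_clock[OF True]
    show ?thesis unfolding opens_def by measurable
  qed simp
  have R [measurable]: "Measurable.pred (clock_measure E) (\<lambda>U. (x, y) \<in> ?R U ^^ n)" for n y
  proof (induction n arbitrary: y)
    case (Suc n)
    note [measurable] = this F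
    have *: "(x, y) \<in> ?R U ^^ Suc n \<longleftrightarrow> (\<exists>z. (x, z) \<in> ?R U ^^ n \<and> {z, y} \<in> ?F U)" for U
      unfolding relpow.simps by blast
    show ?case unfolding * by measurable
  qed simp
  have unbounded: "(\<forall>m. \<exists>n\<ge>m. n \<in> to_nat ` {y \<in> V. P y}) \<longleftrightarrow> (\<forall>m. \<exists>y\<in>V. to_nat y \<ge> m \<and> P y)" for P
    by blast
  have cluster: "open_cluster V (?F U) x = {y \<in> V. \<exists>n. (x, y) \<in> ?R U ^^ n}" for U
    unfolding open_cluster_def rtrancl_is_UN_relpow by simp
  have "infinite (open_cluster V (?F U) x) \<longleftrightarrow> (\<forall>m. \<exists>y\<in>V. to_nat y \<ge> m \<and> (\<exists>n. (x, y) \<in> ?R U ^^ n))" for U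
  proof -
    have "infinite (open_cluster V (?F U) x) \<longleftrightarrow> infinite (to_nat ` open_cluster V (?F U) x)"
      by (simp add: finite_image_iff)
    also have "\<dots> \<longleftrightarrow> (\<forall>m. \<exists>y\<in>V. to_nat y \<ge> m \<and> (\<exists>n. (x, y) \<in> ?R U ^^ n))"
      unfolding infinite_nat_iff_unbounded_le cluster unbounded ..
    finally show ?thesis .
  qed
  note * = this[unfolded Bex_def]
  show ?thesis unfolding * by measurable
qed

text \<open>For well-founded clocks \<open>cdp_config\<close> is the explicit solution, so the two
  events differ at most by a null set, which the completion absorbs.\<close>

lemma percolation_prob_eq:
  fixes V :: "'v::countable set"
  assumes fin: "\<And>e. e \<in> E \<Longrightarrow> finite {f \<in> E. f \<inter> e \<noteq> {}}"
    and wf: "AE U in clock_measure E. wf (earlier E U)" and t: "t \<in> {0..1}"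
  shows "percolation_prob V E x k t = measure (clock_measure E)
    {U \<in> space (clock_measure E). infinite (open_cluster V {e \<in> E. U e < t \<and> opens V E k U e} x)}"
proof -
  let ?M = "clock_measure E"
  let ?P = "\<lambda>U. infinite (open_cluster V (cdp_config V E k U t) x)"
  let ?Q = "\<lambda>U. infinite (open_cluster V {e \<in> E. U e < t \<and> opens V E k U e} x)"
  have eq: "AE U in ?M. ?P U = ?Q U"
    using wf AE_space
  proof eventually_elim
    case (elim U)
    then have "U e \<in> {0..1}" if "e \<in> E" for e
      using that by (auto simp: clock_measure_def space_PiM space_restrict_space PiE_iff)
    then show ?case using cdp_config_eq[OF elim(1) fin _ t] by simp
  qed
  then have "AE U in ?M. \<not> (?P U \<noteq> ?Q U)" by eventually_elim simp
  then have [measurable]: "Measurable.pred (completion ?M) (\<lambda>U. ?P U \<noteq> ?Q U)"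
    by (rule sets_completion_AE)
  have Q: "Measurable.pred ?M ?Q" by (rule pred_infinite_open_cluster)
  note [measurable] = measurable_completion[OF Q]
  \<comment> \<open>\<open>?P\<close> is recovered as the exclusive or of the null discrepancy and
    the measurable \<open>?Q\<close>.\<close>
  have "Measurable.pred (completion ?M) (\<lambda>U. (?P U \<noteq> ?Q U) \<noteq> ?Q U)" by measurable
  then have "Measurable.pred (completion ?M) ?P" by (rule back_subst[of "Measurable.pred (completion ?M)"]) auto
  then have "percolation_prob V E x k t = measure (completion ?M) {U \<in> space ?M. ?Q U}"
    unfolding percolation_prob_def
    using AE_completion[OF eq] measurable_completion[OF Q]
    by (intro measure_eq_AE) (auto simp: pred_def)
  also have "\<dots> = measure ?M {U \<in> space ?M. ?Q U}"
    using Q by (intro measure_completion) (simp add: pred_def)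
  finally show ?thesis .
qed

section \<open>Effective edges of the tree\<close>

text \<open>Edges are named by their lower endpoint. Since \<open>butlast [] = []\<close>, the root
  yields a singleton, which is no edge; hence the recurring condition
  \<open>x \<noteq> []\<close>.\<close>

definition edge_to :: "nat list \<Rightarrow> nat list edge" where
  "edge_to x = {butlast x, x}"

lemma edge_to_snoc [simp]: "edge_to (x @ [a]) = {x, x @ [a]}"
  by (simp add: edge_to_def)

lemma inj_on_edge_to: "inj_on edge_to {x. x \<noteq> []}"
proof (rule inj_onI)
  fix x y :: "nat list"
  assume xy: "x \<in> {x. x \<noteq> []}" "y \<in> {x. x \<noteq> []}" "edge_to x = edge_to y"
  then have "length (butlast x) < length x" "length (butlast y) < length y" by auto
  moreover have "x = y \<or> (butlast x = y \<and> x = butlast y)"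
    using xy(3) unfolding edge_to_def doubleton_eq_iff by blast
  ultimately show "x = y" by (metis less_asym)
qed

lemma eventually_const_iff:
  fixes P :: "nat \<Rightarrow> bool"
  assumes "\<And>n. n \<ge> N \<Longrightarrow> P n = Q"
  shows "(\<exists>M. \<forall>n\<ge>M. P n) \<longleftrightarrow> Q"
proof
  assume "\<exists>M. \<forall>n\<ge>M. P n"
  then obtain M where "\<forall>n\<ge>M. P n" ..
  then have "P (max N M)" by simp
  then show Q using assms[of "max N M"] by simp
qed (use assms in auto)

text \<open>A member of \<open>A\<close> outside the counted set with least \<open>f\<close> value
  has at least \<open>k\<close> members of \<open>A\<close> strictly below it, and minimality puts
  all of these into the counted set. Ties in \<open>f\<close> are allowed.\<close>

lemma card_first_ge:
  fixes f :: "'b \<Rightarrow> 'c::linorder"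
  assumes "finite A" "k \<le> card A"
  shows "k \<le> card {b \<in> A. card {c \<in> A. f c < f b} < k}" (is "_ \<le> card ?B")
proof (cases "?B = A")
  case False
  define b where "b = arg_min_on f (A - ?B)"
  have fin: "finite (A - ?B)" and ne: "A - ?B \<noteq> {}" using False assms by auto
  have b: "b \<in> A - ?B" "\<And>c. c \<in> A - ?B \<Longrightarrow> \<not> f c < f b"
    using arg_min_if_finite[OF fin ne, of f, folded b_def] by blast+
  have "{c \<in> A. f c < f b} \<subseteq> ?B"
  proof
    fix c assume c: "c \<in> {c \<in> A. f c < f b}"
    show "c \<in> ?B"
    proof (rule ccontr)
      assume "c \<notin> ?B"
      then show False using b(2)[of c] c by blast
    qed
  qed
  then have "card {c \<in> A. f c < f b} \<le> card ?B" using assms by (intro card_mono) auto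
  moreover have "k \<le> card {c \<in> A. f c < f b}" using b(1) by auto
  ultimately show ?thesis by simp
qed (use assms in simp)

section \<open>Vertices and edges of the tree, availability and effectiveness\<close>

context
  fixes d :: nat
begin

lemma Nil_in_tree_vertices: "[] \<in> tree_vertices d"
  by (simp add: tree_vertices_def)

lemma snoc_in_tree_vertices: "x @ [a] \<in> tree_vertices d \<longleftrightarrow> x \<in> tree_vertices d \<and> a \<in> {1..d}"
  by (auto simp: tree_vertices_def)

lemma butlast_in_tree_vertices: "x \<in> tree_vertices d \<Longrightarrow> butlast x \<in> tree_vertices d"
  by (auto simp: tree_vertices_def dest: in_set_butlastD)

lemma tree_edges_eq: "tree_edges d = edge_to ` (tree_vertices d - {[]})"
proof
  show "tree_edges d \<subseteq> edge_to ` (tree_vertices d - {[]})"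
  proof
    fix e assume "e \<in> tree_edges d"
    then obtain x a where "e = edge_to (x @ [a])" "x @ [a] \<in> tree_vertices d"
      unfolding tree_edges_def snoc_in_tree_vertices by auto
    then show "e \<in> edge_to ` (tree_vertices d - {[]})" by blast
  qed
  show "edge_to ` (tree_vertices d - {[]}) \<subseteq> tree_edges d"
  proof
    fix e assume "e \<in> edge_to ` (tree_vertices d - {[]})"
    then obtain x where x: "x \<in> tree_vertices d" "x \<noteq> []" "e = edge_to x" by blast
    then obtain y a where "x = y @ [a]" by (metis append_butlast_last_id)
    with x show "e \<in> tree_edges d" by (auto simp: tree_edges_def snoc_in_tree_vertices)
  qed
qed

lemma edge_to_in_tree_edges: "x \<in> tree_vertices d \<Longrightarrow> x \<noteq> [] \<Longrightarrow> edge_to x \<in> tree_edges d"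
  by (auto simp: tree_edges_eq)

lemma tree_edge_cases:
  assumes "e \<in> tree_edges d"
  obtains x where "x \<in> tree_vertices d" "x \<noteq> []" "e = edge_to x"
  using assms by (auto simp: tree_edges_eq)

lemma pair_in_tree_edges_iff:
  assumes "u \<in> tree_vertices d"
  shows "{u, v} \<in> tree_edges d \<longleftrightarrow> (\<exists>b\<in>{1..d}. v = u @ [b]) \<or> (u \<noteq> [] \<and> v = butlast u)"
proof
  assume "{u, v} \<in> tree_edges d"
  then obtain x a where xa: "{u, v} = {x, x @ [a]}" "x \<in> tree_vertices d" "a \<in> {1..d}"
    by (auto simp: tree_edges_def)
  then show "(\<exists>b\<in>{1..d}. v = u @ [b]) \<or> (u \<noteq> [] \<and> v = butlast u)"
    by (auto simp: doubleton_eq_iff)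
next
  assume "(\<exists>b\<in>{1..d}. v = u @ [b]) \<or> (u \<noteq> [] \<and> v = butlast u)"
  then show "{u, v} \<in> tree_edges d"
  proof
    assume "u \<noteq> [] \<and> v = butlast u"
    then show ?thesis using edge_to_in_tree_edges[OF assms] by (simp add: edge_to_def insert_commute)
  next
    assume "\<exists>b\<in>{1..d}. v = u @ [b]"
    then show ?thesis using assms unfolding tree_edges_def by blast
  qed
qed

lemma tree_edges_degree:
  assumes e: "e \<in> tree_edges d"
  shows "finite {f \<in> tree_edges d. f \<inter> e \<noteq> {}}" "card {f \<in> tree_edges d. f \<inter> e \<noteq> {}} \<le> 2 * Suc d"
proof -
  obtain x where x: "x \<in> tree_vertices d" "x \<noteq> []" "e = edge_to x"
    using e by (rule tree_edge_cases)
  \<comment> \<open>The edges at \<open>u\<close>: one to the parent, \<open>d\<close> to the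
    children. At the root the first is the singleton \<open>{[]}\<close>, which only enlarges the
    set.\<close>
  define N where "N u = insert (edge_to u) ((\<lambda>b. edge_to (u @ [b])) ` {1..d})" for u
  have N: "finite (N u)" "card (N u) \<le> Suc d" for u
    using card_image_le[of "{1..d}" "\<lambda>b. edge_to (u @ [b])"]
    by (auto simp: N_def card_insert_if simp del: edge_to_snoc)
  have "{f \<in> tree_edges d. f \<inter> e \<noteq> {}} \<subseteq> N (butlast x) \<union> N x"
  proof
    fix f assume "f \<in> {f \<in> tree_edges d. f \<inter> e \<noteq> {}}"
    then obtain y a u where y: "f = {y, y @ [a]}" "a \<in> {1..d}" "u \<in> f" "u \<in> e"
      by (auto simp: tree_edges_def)
    then have "f \<in> N u" by (auto simp: N_def)
    with y x show "f \<in> N (butlast x) \<union> N x" by (auto simp: edge_to_def)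
  qed
  note sub = this
  have card: "card (N (butlast x) \<union> N x) \<le> 2 * Suc d"
    by (rule order_trans[OF card_Un_le]) (simp only: mult_2 add_mono N)
  show "finite {f \<in> tree_edges d. f \<inter> e \<noteq> {}}"
    by (rule finite_subset[OF sub]) (simp add: N(1))
  show "card {f \<in> tree_edges d. f \<inter> e \<noteq> {}} \<le> 2 * Suc d"
    by (rule order_trans[OF card_mono[OF _ sub] card]) (simp add: N(1))
qed

lemma AE_wf_earlier_tree: "AE U in clock_measure (tree_edges d). wf (earlier (tree_edges d) U)"
proof (rule AE_wf_earlier)
  show "countable (tree_edges d)" unfolding tree_edges_eq by (intro countable_image) simp
qed (use tree_edges_degree in auto)

text \<open>
  The clock of the edge joining a vertex \<open>x \<noteq> []\<close> to its parent is written \<open>W x\<close>, so that the clocks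
  of the subtree below \<open>x\<close> are \<open>\<lambda>y. W (x @ y)\<close>. The clock \<open>W []\<close> belongs to a phantom edge above the
  root; it makes the clocks of a subtree distributed like those of the whole tree. The recursion
  for availability does not terminate, so it is defined as the limit of finite-depth versions.
\<close>

primrec avail_approx :: "nat \<Rightarrow> real \<Rightarrow> (nat list \<Rightarrow> real) \<Rightarrow> bool" where
  "avail_approx 0 s W \<longleftrightarrow> True"
| "avail_approx (Suc n) s W \<longleftrightarrow>
     card {a \<in> {1..d}. W [a] < s \<and> avail_approx n (W [a]) (\<lambda>y. W (a # y))} \<le> 2"

definition avail :: "real \<Rightarrow> (nat list \<Rightarrow> real) \<Rightarrow> bool" where
  "avail s W \<longleftrightarrow> (\<exists>N. \<forall>n\<ge>N. avail_approx n s W)"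

definition effective :: "(nat list \<Rightarrow> real) \<Rightarrow> bool" where
  "effective W \<longleftrightarrow> avail (W []) W"

text \<open>Survival for \<open>n\<close> generations of the tree of first two effective child
  edges. The bound 1 on earlier effective siblings leaves room for the edge to the parent: together
  they occupy at most two places, still below the restriction 3.\<close>

primrec lineage :: "real \<Rightarrow> nat \<Rightarrow> (nat list \<Rightarrow> real) \<Rightarrow> bool" where
  "lineage t 0 W \<longleftrightarrow> True"
| "lineage t (Suc n) W \<longleftrightarrow> (\<exists>a\<in>{1..d}. W [a] < t \<and> effective (\<lambda>y. W (a # y)) \<and>
     card {b \<in> {1..d}. effective (\<lambda>y. W (b # y)) \<and> W [b] < W [a]} \<le> 1 \<and>
     lineage t n (\<lambda>y. W (a # y)))"

text \<open>Passes from clocks of words to clocks of edges and drops the phantom clock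
  \<open>W []\<close>.\<close>

definition edge_clocks :: "(nat list \<Rightarrow> real) \<Rightarrow> nat list edge \<Rightarrow> real" where
  "edge_clocks W = (\<lambda>e\<in>tree_edges d. W (inv_into {x. x \<noteq> []} edge_to e))"

lemma edge_clocks_edge_to:
  "x \<in> tree_vertices d \<Longrightarrow> x \<noteq> [] \<Longrightarrow> edge_clocks W (edge_to x) = W x"
  by (simp add: edge_clocks_def edge_to_in_tree_edges inv_into_f_f[OF inj_on_edge_to])

lemma earlier_child:
  assumes "x \<in> tree_vertices d" "x \<noteq> []" "b \<in> {1..d}" "W (x @ [b]) < W x"
  shows "(edge_to (x @ [b]), edge_to x) \<in> earlier (tree_edges d) (edge_clocks W)"
proof -
  have xb: "x @ [b] \<in> tree_vertices d" using assms by (simp add: snoc_in_tree_vertices)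
  then have "edge_clocks W (edge_to (x @ [b])) < edge_clocks W (edge_to x)"
    using assms edge_clocks_edge_to[of "x @ [b]" W] edge_clocks_edge_to[of x W] by simp
  moreover have "x \<in> edge_to (x @ [b]) \<inter> edge_to x" by (auto simp: edge_to_def)
  moreover have "edge_to x \<in> tree_edges d" "edge_to (x @ [b]) \<in> tree_edges d"
    using assms xb by (blast intro: edge_to_in_tree_edges)+
  ultimately show ?thesis unfolding earlier_def by blast
qed

lemma avail_approx_subtree:
  "avail_approx (Suc n) s (\<lambda>y. W (x @ y)) \<longleftrightarrow>
    card {a \<in> {1..d}. W (x @ [a]) < s \<and> avail_approx n (W (x @ [a])) (\<lambda>y. W ((x @ [a]) @ y))} \<le> 2"
  by simp

text \<open>Availability at time \<open>W x\<close> consults only child edges ringing before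
  \<open>W x\<close>, and these precede \<open>edge_to x\<close> in \<open>earlier\<close>, so
  \<open>wf_finite_depth\<close> applies.\<close>

lemma ex_avail_approx_const:
  assumes wf: "wf (earlier (tree_edges d) (edge_clocks W))" and x: "x \<in> tree_vertices d" "x \<noteq> []"
  shows "\<exists>N. \<forall>n\<ge>N. avail_approx n (W x) (\<lambda>y. W (x @ y)) = avail_approx N (W x) (\<lambda>y. W (x @ y))"
proof -
  \<comment> \<open>The predicate on words is carried over to edges, the index set of
    \<open>earlier\<close>; by injectivity of \<open>edge_to\<close> the quantifier concerns a
    single \<open>x\<close>.\<close>
  define P where "P n e \<longleftrightarrow> (\<forall>x\<in>tree_vertices d. x \<noteq> [] \<longrightarrow> e = edge_to x \<longrightarrow>
    avail_approx n (W x) (\<lambda>y. W (x @ y)))" for n e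
  have P: "P n (edge_to x) = avail_approx n (W x) (\<lambda>y. W (x @ y))"
    if "x \<in> tree_vertices d" "x \<noteq> []" for x n
    using that inj_onD[OF inj_on_edge_to] unfolding P_def by blast
  have "\<exists>N. \<forall>n\<ge>N. P n (edge_to x) = P N (edge_to x)"
  proof (rule wf_finite_depth[OF wf])
    show "finite {f. (f, e) \<in> earlier (tree_edges d) (edge_clocks W)}" for e
      using tree_edges_degree(1)[of e]
      by (cases "e \<in> tree_edges d") (auto simp: earlier_def intro: rev_finite_subset)
    fix n m e
    assume IH: "\<And>f. (f, e) \<in> earlier (tree_edges d) (edge_clocks W) \<Longrightarrow> P n f = P m f"
    have "avail_approx (Suc n) (W x) (\<lambda>y. W (x @ y)) = avail_approx (Suc m) (W x) (\<lambda>y. W (x @ y))"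
      if x: "x \<in> tree_vertices d" "x \<noteq> []" "e = edge_to x" for x
    proof -
      have "avail_approx n (W (x @ [a])) (\<lambda>y. W ((x @ [a]) @ y)) =
          avail_approx m (W (x @ [a])) (\<lambda>y. W ((x @ [a]) @ y))"
        if "a \<in> {1..d}" "W (x @ [a]) < W x" for a
        using IH[unfolded x(3), OF earlier_child[OF x(1,2) that]] P[of "x @ [a]"] x that
        by (simp add: snoc_in_tree_vertices)
      then have "{a \<in> {1..d}. W (x @ [a]) < W x \<and> avail_approx n (W (x @ [a])) (\<lambda>y. W ((x @ [a]) @ y))} =
          {a \<in> {1..d}. W (x @ [a]) < W x \<and> avail_approx m (W (x @ [a])) (\<lambda>y. W ((x @ [a]) @ y))}"
        by (intro Collect_cong conj_cong refl)
      then show ?thesis unfolding avail_approx_subtree by simp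
    qed
    then show "P (Suc n) e = P (Suc m) e" unfolding P_def by blast
  qed
  then show ?thesis unfolding P[OF x] .
qed

text \<open>The recursive equation for availability at an arbitrary time \<open>s\<close>, also at
  the root: effectiveness of each of the finitely many children has settled by some common
  depth.\<close>

lemma avail_subtree_iff:
  assumes wf: "wf (earlier (tree_edges d) (edge_clocks W))" and x: "x \<in> tree_vertices d"
  shows "avail s (\<lambda>y. W (x @ y)) \<longleftrightarrow>
    card {a \<in> {1..d}. W (x @ [a]) < s \<and> effective (\<lambda>y. W ((x @ [a]) @ y))} \<le> 2"
proof -
  have "\<exists>N. \<forall>n\<ge>N. avail_approx n (W (x @ [a])) (\<lambda>y. W ((x @ [a]) @ y)) = effective (\<lambda>y. W ((x @ [a]) @ y))"
    if "a \<in> {1..d}" for a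
  proof -
    have "x @ [a] \<in> tree_vertices d" "x @ [a] \<noteq> []" using x that by (simp_all add: snoc_in_tree_vertices)
    from ex_avail_approx_const[OF wf this] obtain N where N: "\<forall>n\<ge>N.
      avail_approx n (W (x @ [a])) (\<lambda>y. W ((x @ [a]) @ y)) = avail_approx N (W (x @ [a])) (\<lambda>y. W ((x @ [a]) @ y))" ..
    have "effective (\<lambda>y. W ((x @ [a]) @ y)) = avail_approx N (W (x @ [a])) (\<lambda>y. W ((x @ [a]) @ y))"
      unfolding effective_def avail_def append_Nil2 by (rule eventually_const_iff) (use N in blast)
    show ?thesis unfolding \<open>effective (\<lambda>y. W ((x @ [a]) @ y)) = _\<close> by (rule exI[of _ N]) (rule N)
  qed
  then have "\<forall>a\<in>{1..d}. \<exists>N. \<forall>n\<ge>N.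
      avail_approx n (W (x @ [a])) (\<lambda>y. W ((x @ [a]) @ y)) = effective (\<lambda>y. W ((x @ [a]) @ y))" ..
  from bchoice[OF this] obtain N where "\<forall>a\<in>{1..d}. \<forall>n\<ge>N a.
      avail_approx n (W (x @ [a])) (\<lambda>y. W ((x @ [a]) @ y)) = effective (\<lambda>y. W ((x @ [a]) @ y))" ..
  note N = this[rule_format]
  define M where "M = Max (N ` {1..d})"
  have M: "N a \<le> M" if "a \<in> {1..d}" for a unfolding M_def using that by (intro Max_ge) auto
  have "avail_approx n s (\<lambda>y. W (x @ y)) \<longleftrightarrow>
    card {a \<in> {1..d}. W (x @ [a]) < s \<and> effective (\<lambda>y. W ((x @ [a]) @ y))} \<le> 2" if n: "n \<ge> Suc M" for n
  proof -
    obtain m where m: "n = Suc m" "m \<ge> M" using n by (cases n) auto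
    have "{a \<in> {1..d}. W (x @ [a]) < s \<and> avail_approx m (W (x @ [a])) (\<lambda>y. W ((x @ [a]) @ y))} =
      {a \<in> {1..d}. W (x @ [a]) < s \<and> effective (\<lambda>y. W ((x @ [a]) @ y))}"
      by (intro Collect_cong conj_cong refl N order_trans[OF M m(2)])
    then show ?thesis unfolding m(1) avail_approx_subtree by simp
  qed
  then show ?thesis unfolding avail_def by (rule eventually_const_iff)
qed

section \<open>Comparison of open and effective edges for fixed well-founded clocks\<close>

context
  fixes W :: "nat list \<Rightarrow> real"
  assumes wf: "wf (earlier (tree_edges d) (edge_clocks W))"
begin

abbreviation edge_opens :: "nat list \<Rightarrow> bool" where
  "edge_opens x \<equiv> opens (tree_vertices d) (tree_edges d) (\<lambda>_. 3) (edge_clocks W) (edge_to x)"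

abbreviation subtree_effective :: "nat list \<Rightarrow> bool" where
  "subtree_effective x \<equiv> effective (\<lambda>y. W (x @ y))"

lemma subtree_effective_iff:
  assumes "x \<in> tree_vertices d"
  shows "subtree_effective x \<longleftrightarrow> card {a \<in> {1..d}. W (x @ [a]) < W x \<and> subtree_effective (x @ [a])} \<le> 2"
  using avail_subtree_iff[OF wf assms, of "W x"] unfolding effective_def by simp

text \<open>The neighbours of the lower endpoint are its children; those of the upper endpoint are
  the siblings of \<open>x\<close> and, unless it is the root, its own parent. The strict comparison
  with \<open>W x\<close> already removes \<open>x\<close> from its siblings.\<close>

lemma edge_opens_iff:
  assumes x: "x \<in> tree_vertices d" "x \<noteq> []"
  shows "edge_opens x \<longleftrightarrow>
    card {b \<in> {1..d}. W (x @ [b]) < W x \<and> edge_opens (x @ [b])} \<le> 2 \<and>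
    card {b \<in> {1..d}. W (butlast x @ [b]) < W x \<and> edge_opens (butlast x @ [b])} +
      (if butlast x \<noteq> [] \<and> W (butlast x) < W x \<and> edge_opens (butlast x) then 1 else 0) \<le> 2"
proof -
  let ?V = "tree_vertices d" and ?E = "tree_edges d" and ?U = "edge_clocks W"
  let ?S = "\<lambda>u. {v \<in> ?V - (edge_to x - {u}). {u, v} \<in> ?E \<and> ?U {u, v} < ?U (edge_to x) \<and>
    opens ?V ?E (\<lambda>_. 3) ?U {u, v}}"
  let ?C = "\<lambda>u. {b \<in> {1..d}. W (u @ [b]) < W x \<and> edge_opens (u @ [b])}"
  let ?p = "butlast x"
  have p: "?p \<in> ?V" using x by (simp add: butlast_in_tree_vertices)
  have len: "length ?p < length x" using x by simp
  have child: "u @ [b] \<in> ?V" "?U (edge_to (u @ [b])) = W (u @ [b])" "{u, u @ [b]} \<in> ?E"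
    if "u \<in> ?V" "b \<in> {1..d}" for u b
    using that edge_clocks_edge_to[of "u @ [b]" W] edge_to_in_tree_edges[of "u @ [b]"]
    by (auto simp: snoc_in_tree_vertices)
  have Ux: "?U (edge_to x) = W x" using x by (rule edge_clocks_edge_to)
  have "?S x = (\<lambda>b. x @ [b]) ` ?C x"
  proof (intro equalityI subsetI)
    fix v assume v: "v \<in> ?S x"
    then have "v \<noteq> ?p" using len by (auto simp: edge_to_def)
    with v obtain b where "b \<in> {1..d}" "v = x @ [b]"
      using pair_in_tree_edges_iff[OF x(1), of v] by auto
    with v child[OF x(1), of b] Ux show "v \<in> (\<lambda>b. x @ [b]) ` ?C x" by auto
  next
    fix v assume "v \<in> (\<lambda>b. x @ [b]) ` ?C x"
    then obtain b where b: "b \<in> ?C x" "v = x @ [b]" by blast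
    moreover from b have "v \<notin> edge_to x" by (auto simp: edge_to_def dest!: arg_cong[where f = length])
    ultimately show "v \<in> ?S x" using child[OF x(1), of b] Ux by auto
  qed
  then have Sx: "card (?S x) = card (?C x)" by (simp add: card_image inj_on_def)
  have "?S ?p = (\<lambda>b. ?p @ [b]) ` ?C ?p \<union>
    (if ?p \<noteq> [] \<and> W ?p < W x \<and> edge_opens ?p then {butlast ?p} else {})" (is "_ = ?A \<union> ?B")
  proof (intro equalityI subsetI)
    fix v assume v: "v \<in> ?S ?p"
    then consider b where "b \<in> {1..d}" "v = ?p @ [b]" | "?p \<noteq> []" "v = butlast ?p"
      using pair_in_tree_edges_iff[OF p, of v] by auto
    then show "v \<in> ?A \<union> ?B"
    proof cases
      case 1
      with v child[OF p, of b] Ux show ?thesis by auto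
    next
      case 2
      then have "{?p, v} = edge_to ?p" by (auto simp: edge_to_def)
      with v 2 edge_clocks_edge_to[OF p] Ux show ?thesis by auto
    qed
  next
    fix v assume "v \<in> ?A \<union> ?B"
    then show "v \<in> ?S ?p"
    proof
      assume "v \<in> ?A"
      then obtain b where b: "b \<in> ?C ?p" "v = ?p @ [b]" by blast
      then have "v \<noteq> x" "v \<noteq> ?p" by auto
      then have "v \<notin> edge_to x" by (auto simp: edge_to_def)
      then show ?thesis using b child[OF p, of b] Ux by auto
    next
      assume B: "v \<in> ?B"
      then have v: "v = butlast ?p" "?p \<noteq> []" "W ?p < W x" "edge_opens ?p" by (auto split: if_splits)
      then have *: "{?p, v} = edge_to ?p" by (auto simp: edge_to_def)
      have "length v < length ?p" unfolding v(1) length_butlast[of ?p] using v(2) by (simp del: length_butlast)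
      then have "v \<notin> edge_to x" using len by (auto simp: edge_to_def)
      then show ?thesis
        using v * edge_clocks_edge_to[OF p v(2)] Ux edge_to_in_tree_edges[OF p v(2)] butlast_in_tree_vertices[OF p]
        by auto
    qed
  qed
  moreover have "?A \<inter> ?B = {}" by (auto dest!: arg_cong[where f = length] split: if_splits)
  ultimately have Sp: "card (?S ?p) = card (?C ?p) +
      (if ?p \<noteq> [] \<and> W ?p < W x \<and> edge_opens ?p then 1 else 0)"
    by (simp add: card_Un_disjoint card_image inj_on_def)
  have endpoints: "(\<forall>u\<in>edge_to x. P u) \<longleftrightarrow> P ?p \<and> P x" for P
    by (simp add: edge_to_def)
  have "edge_opens x \<longleftrightarrow> int (card (?S ?p)) < 3 \<and> int (card (?S x)) < 3"
    using opens_iff[OF wf tree_edges_degree(1) edge_to_in_tree_edges[OF x], of ?V "\<lambda>_. 3"]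
    by (simp only: endpoints)
  then show ?thesis unfolding Sx Sp by linarith
qed

text \<open>If at least three effective child edges ring before \<open>W x\<close>, the earliest
  three or more of them open: inductively, the open edges they meet from below or as earlier
  siblings are effective, hence at most two at either end. They then block the edge above
  \<open>x\<close>.\<close>

lemma edge_opens_imp_effective:
  assumes "x \<in> tree_vertices d" "x \<noteq> []" "edge_opens x"
  shows "subtree_effective x"
proof -
  have "\<forall>x. x \<in> tree_vertices d \<longrightarrow> x \<noteq> [] \<longrightarrow> edge_opens x \<longrightarrow> e = edge_to x \<longrightarrow> subtree_effective x" for e
    \<comment> \<open>The transitive closure is needed because the hypothesis is also used for
      grandchildren of \<open>x\<close>.\<close>
    using wf_trancl[OF wf]
  proof (induction e)
    case (less e)
    show ?case
    proof (intro allI impI)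
      fix x assume x: "x \<in> tree_vertices d" "x \<noteq> []" and ox: "edge_opens x" and e: "e = edge_to x"
      let ?A = "{b \<in> {1..d}. W (x @ [b]) < W x \<and> subtree_effective (x @ [b])}"
      let ?B = "{b \<in> ?A. card {c \<in> ?A. W (x @ [c]) < W (x @ [b])} < 3}"
      show "subtree_effective x"
      proof (rule ccontr)
        assume "\<not> subtree_effective x"
        then have "3 \<le> card ?A" using subtree_effective_iff[OF x(1)] by simp
        then have "3 \<le> card ?B" by (intro card_first_ge) auto
        also have "card ?B \<le> card {b \<in> {1..d}. W (x @ [b]) < W x \<and> edge_opens (x @ [b])}"
        proof (intro card_mono subsetI)
          fix b assume b: "b \<in> ?B"
          then have b1: "b \<in> {1..d}" "W (x @ [b]) < W x" by auto
          have xb: "x @ [b] \<in> tree_vertices d" "x @ [b] \<noteq> []"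
            using x b1 by (auto simp: snoc_in_tree_vertices)
          have lt: "(edge_to (x @ [b]), e) \<in> (earlier (tree_edges d) (edge_clocks W))\<^sup>+"
            unfolding e using earlier_child[OF x b1] by blast
          have eff1: "subtree_effective (x @ [c])"
            if "c \<in> {1..d}" "W (x @ [c]) < W x" "edge_opens (x @ [c])" for c
          proof -
            have "(edge_to (x @ [c]), e) \<in> (earlier (tree_edges d) (edge_clocks W))\<^sup>+"
              unfolding e using earlier_child[OF x that(1,2)] by blast
            moreover have "x @ [c] \<in> tree_vertices d" "x @ [c] \<noteq> []"
              using x that unfolding snoc_in_tree_vertices by auto
            ultimately show ?thesis using less.IH that(3) by blast
          qed
          have eff2: "subtree_effective ((x @ [b]) @ [c])"
            if "c \<in> {1..d}" "W ((x @ [b]) @ [c]) < W (x @ [b])" "edge_opens ((x @ [b]) @ [c])" for c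
          proof -
            have "(edge_to ((x @ [b]) @ [c]), e) \<in> (earlier (tree_edges d) (edge_clocks W))\<^sup>+"
              using earlier_child[OF xb that(1,2)] lt by (rule trancl_into_trancl2)
            moreover have "(x @ [b]) @ [c] \<in> tree_vertices d" "(x @ [b]) @ [c] \<noteq> []"
              using xb that unfolding snoc_in_tree_vertices by auto
            ultimately show ?thesis using less.IH that(3) by blast
          qed
          have "card {c \<in> {1..d}. W ((x @ [b]) @ [c]) < W (x @ [b]) \<and> edge_opens ((x @ [b]) @ [c])} \<le>
            card {c \<in> {1..d}. W ((x @ [b]) @ [c]) < W (x @ [b]) \<and> subtree_effective ((x @ [b]) @ [c])}"
            using eff2 by (intro card_mono) auto
          also have "\<dots> \<le> 2" using b subtree_effective_iff[OF xb(1)] by blast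
          finally have 1: "card {c \<in> {1..d}. W ((x @ [b]) @ [c]) < W (x @ [b]) \<and> edge_opens ((x @ [b]) @ [c])} \<le> 2" .
          have "card {c \<in> {1..d}. W (x @ [c]) < W (x @ [b]) \<and> edge_opens (x @ [c])} \<le>
            card {c \<in> ?A. W (x @ [c]) < W (x @ [b])}"
            using eff1 b1 by (intro card_mono) auto
          also have "\<dots> \<le> 2" using b by simp
          finally have 2: "card {c \<in> {1..d}. W (x @ [c]) < W (x @ [b]) \<and> edge_opens (x @ [c])} \<le> 2" .
          \<comment> \<open>The edge above \<open>x\<close> does not count here, since it rings
            after the edge to \<open>x @ [b]\<close>.\<close>
          have "edge_opens (x @ [b])"
            using edge_opens_iff[OF xb] 1 2 b1 by simp
          then show "b \<in> {b \<in> {1..d}. W (x @ [b]) < W x \<and> edge_opens (x @ [b])}" using b1 by simp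
        qed simp
        also have "\<dots> \<le> 2" using edge_opens_iff[OF x] ox by blast
        finally show False by simp
      qed
    qed
  qed
  with assms show ?thesis by blast
qed

text \<open>Open implies effective, so at the upper endpoint at most one sibling is already open,
  and the edge to the parent adds at most one more. At the lower endpoint effectiveness leaves at
  most two open child edges.\<close>

lemma edge_opensI:
  assumes x: "x \<in> tree_vertices d" and a: "a \<in> {1..d}" and eff: "subtree_effective (x @ [a])"
    and first: "card {b \<in> {1..d}. subtree_effective (x @ [b]) \<and> W (x @ [b]) < W (x @ [a])} \<le> 1"
  shows "edge_opens (x @ [a])"
proof -
  have xa: "x @ [a] \<in> tree_vertices d" "x @ [a] \<noteq> []" using x a by (auto simp: snoc_in_tree_vertices)
  have eff1: "subtree_effective (y @ [c])" if "y \<in> tree_vertices d" "c \<in> {1..d}" "edge_opens (y @ [c])" for y c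
    using edge_opens_imp_effective[of "y @ [c]"] that by (simp add: snoc_in_tree_vertices del: edge_to_snoc)
  have "card {c \<in> {1..d}. W ((x @ [a]) @ [c]) < W (x @ [a]) \<and> edge_opens ((x @ [a]) @ [c])} \<le>
    card {c \<in> {1..d}. W ((x @ [a]) @ [c]) < W (x @ [a]) \<and> subtree_effective ((x @ [a]) @ [c])}"
    using eff1[OF xa(1)] by (intro card_mono) auto
  also have "\<dots> \<le> 2" using eff subtree_effective_iff[OF xa(1)] by blast
  finally have 1: "card {c \<in> {1..d}. W ((x @ [a]) @ [c]) < W (x @ [a]) \<and> edge_opens ((x @ [a]) @ [c])} \<le> 2" .
  have "card {c \<in> {1..d}. W (x @ [c]) < W (x @ [a]) \<and> edge_opens (x @ [c])} \<le>
    card {b \<in> {1..d}. subtree_effective (x @ [b]) \<and> W (x @ [b]) < W (x @ [a])}"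
    using eff1[OF x] by (intro card_mono) auto
  then show ?thesis using edge_opens_iff[OF xa] 1 first by simp
qed

lemma lineage_reaches:
  "x \<in> tree_vertices d \<Longrightarrow> lineage t n (\<lambda>y. W (x @ y)) \<Longrightarrow>
    \<exists>y\<in>tree_vertices d. length y = length x + n \<and>
      (x, y) \<in> {(u, v). {u, v} \<in> {e \<in> tree_edges d. edge_clocks W e < t \<and>
        opens (tree_vertices d) (tree_edges d) (\<lambda>_. 3) (edge_clocks W) e}}\<^sup>*"
proof (induction n arbitrary: x)
  case 0
  then show ?case by auto
next
  case (Suc n)
  let ?R = "{(u, v). {u, v} \<in> {e \<in> tree_edges d. edge_clocks W e < t \<and>
        opens (tree_vertices d) (tree_edges d) (\<lambda>_. 3) (edge_clocks W) e}}"
  from Suc.prems(2) obtain a where a: "a \<in> {1..d}" "W (x @ [a]) < t" "subtree_effective (x @ [a])"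
    "card {b \<in> {1..d}. subtree_effective (x @ [b]) \<and> W (x @ [b]) < W (x @ [a])} \<le> 1"
    "lineage t n (\<lambda>y. W ((x @ [a]) @ y))" by auto
  have xa: "x @ [a] \<in> tree_vertices d" "x @ [a] \<noteq> []" using Suc.prems a by (auto simp: snoc_in_tree_vertices)
  have "(x, x @ [a]) \<in> ?R"
    using edge_opensI[OF Suc.prems(1) a(1,3,4)] edge_to_in_tree_edges[OF xa] edge_clocks_edge_to[OF xa, of W] a(2)
    by simp
  moreover from Suc.IH[OF xa(1) a(5)] obtain y where
    "y \<in> tree_vertices d" "length y = length (x @ [a]) + n" "(x @ [a], y) \<in> ?R\<^sup>*" by blast
  ultimately show ?case by (intro bexI[of _ y]) (auto intro: converse_rtrancl_into_rtrancl)
qed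

text \<open>The cluster contains a vertex at every depth, and vertices at different depths are
  different.\<close>

lemma infinite_open_cluster_if_lineage:
  assumes "\<And>n. lineage t n W"
  shows "infinite (open_cluster (tree_vertices d) {e \<in> tree_edges d. edge_clocks W e < t \<and>
    opens (tree_vertices d) (tree_edges d) (\<lambda>_. 3) (edge_clocks W) e} [])" (is "infinite ?C")
proof
  assume "finite ?C"
  then have "finite (length ` ?C)" by simp
  moreover have "length ` ?C = UNIV"
  proof -
    have "n \<in> length ` ?C" for n
      using lineage_reaches[OF Nil_in_tree_vertices, of t n] assms[of n]
      unfolding open_cluster_def by auto
    then show ?thesis by blast
  qed
  ultimately show False by simp
qed

end

end

lemma measurable_card_filter:
  assumes P: "\<And>a::nat. a \<in> A \<Longrightarrow> Measurable.pred M (P a)"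
  shows "(\<lambda>x. card {a \<in> A. P a x}) \<in> measurable M (count_space UNIV)"
proof (rule measurable_card)
  show "{x \<in> space M. a \<in> {a \<in> A. P a x}} \<in> sets M" for a
    using P[of a] by (cases "a \<in> A") (simp_all add: pred_def)
qed

section \<open>One generation of the branching process\<close>

text \<open>Evaluates sums over the exact set of effective children when there are at most two of
  them.\<close>

lemma sum_subsets_card_le_2:
  fixes g :: "nat \<Rightarrow> real"
  assumes "finite I"
  shows "(\<Sum>J | J \<subseteq> I \<and> card J \<le> 2. g (card J)) =
    g 0 + real (card I) * g 1 + real (card I choose 2) * g 2"
proof -
  have "{J. J \<subseteq> I \<and> card J \<le> 2} = (\<Union>j\<in>{0, 1, 2}. {J. J \<subseteq> I \<and> card J = j})"
    by auto
  then have "(\<Sum>J | J \<subseteq> I \<and> card J \<le> 2. g (card J)) =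
      (\<Sum>j\<in>{0, 1, 2}. \<Sum>J | J \<subseteq> I \<and> card J = j. g (card J))"
    using assms by (simp only:) (rule sum.UNION_disjoint, auto)
  also have "\<dots> = (\<Sum>j\<in>{0, 1, 2}. real (card I choose j) * g j)"
    using n_subsets[OF assms] by (intro sum.cong refl) simp
  finally show ?thesis by simp
qed

context prob_space
begin

text \<open>The separate set \<open>G\<close> serves two later choices: \<open>E\<close> itself, and
  the part of \<open>E\<close> without survival.\<close>

lemma prob_PiM_pattern:
  assumes I: "finite I" "J \<subseteq> I" and [measurable]: "E \<in> events" "G \<in> events"
  shows "measure (\<Pi>\<^sub>M a\<in>I. M) {z \<in> space (\<Pi>\<^sub>M a\<in>I. M). (\<forall>a\<in>J. z a \<in> G) \<and> (\<forall>a\<in>I - J. z a \<notin> E)} =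
    prob G ^ card J * (1 - prob E) ^ (card I - card J)"
proof -
  interpret P: finite_product_prob_space "\<lambda>_. M" I
    by unfold_locales (fact I)
  have "{z \<in> space (\<Pi>\<^sub>M a\<in>I. M). (\<forall>a\<in>J. z a \<in> G) \<and> (\<forall>a\<in>I - J. z a \<notin> E)} =
      (\<Pi>\<^sub>E a\<in>I. if a \<in> J then G else space M - E)"
  proof (rule set_eqI)
    fix z
    have "(z \<in> (\<Pi>\<^sub>E a\<in>I. if a \<in> J then G else space M - E)) \<longleftrightarrow>
        z \<in> extensional I \<and> (\<forall>a\<in>I. (a \<in> J \<and> z a \<in> G) \<or> (a \<notin> J \<and> z a \<in> space M \<and> z a \<notin> E))"
      unfolding PiE_iff by (simp add: conj_commute) meson
    then show "z \<in> {z \<in> space (\<Pi>\<^sub>M a\<in>I. M). (\<forall>a\<in>J. z a \<in> G) \<and> (\<forall>a\<in>I - J. z a \<notin> E)} \<longleftrightarrow>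
        z \<in> (\<Pi>\<^sub>E a\<in>I. if a \<in> J then G else space M - E)"
      using I(2) sets.sets_into_space[OF assms(4)] unfolding space_PiM PiE_iff by blast
  qed
  then have "measure (\<Pi>\<^sub>M a\<in>I. M) {z \<in> space (\<Pi>\<^sub>M a\<in>I. M). (\<forall>a\<in>J. z a \<in> G) \<and> (\<forall>a\<in>I - J. z a \<notin> E)} =
      (\<Prod>a\<in>I. prob (if a \<in> J then G else space M - E))"
    by (simp add: P.prob_times)
  also have "\<dots> = (\<Prod>a\<in>J. prob G) * (\<Prod>a\<in>I - J. prob (space M - E))"
    using I by (subst prod.subset_diff[of J I]) (auto simp: mult.commute intro!: arg_cong2[where f = "(*)"] prod.cong)
  finally show ?thesis
    using I by (simp add: prob_compl card_Diff_subset finite_subset)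
qed

text \<open>By Fubini all coordinates but \<open>a\<close> may be frozen. By \<open>inv\<close>, the
  condition \<Theta> then restricts only the value of \<open>T\<close> at coordinate
  \<open>a\<close>, and \<open>thin\<close> holds under every such Borel restriction.\<close>

lemma PiM_thinning:
  fixes T :: "'a \<Rightarrow> real" and a :: 'i
  assumes "finite I" "a \<in> I" and [measurable]: "F \<in> events" "H \<in> events" "random_variable borel T"
    and thin: "\<And>B. B \<in> sets borel \<Longrightarrow>
      \<delta> * prob {w \<in> space M. w \<in> F \<and> T w < t \<and> T w \<in> B} \<le> prob {w \<in> space M. w \<in> F \<and> w \<in> H \<and> T w < t \<and> T w \<in> B}"
    and "\<delta> \<ge> 0"
    and inv: "\<And>u z y. \<Theta> u (z(a := y)) = \<Theta> u z"
    and \<Theta>: "Measurable.pred (borel \<Otimes>\<^sub>M (\<Pi>\<^sub>M a\<in>I - {a}. M)) (\<lambda>p. \<Theta> (fst p) (snd p))"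
    and \<Theta>': "Measurable.pred (\<Pi>\<^sub>M a\<in>I. M) (\<lambda>z. \<Theta> (T (z a)) z)"
  shows "\<delta> * measure (\<Pi>\<^sub>M a\<in>I. M) {z \<in> space (\<Pi>\<^sub>M a\<in>I. M). z a \<in> F \<and> T (z a) < t \<and> \<Theta> (T (z a)) z} \<le>
    measure (\<Pi>\<^sub>M a\<in>I. M) {z \<in> space (\<Pi>\<^sub>M a\<in>I. M). z a \<in> F \<and> z a \<in> H \<and> T (z a) < t \<and> \<Theta> (T (z a)) z}"
proof -
  let ?P = "\<Pi>\<^sub>M a\<in>I. M" and ?P' = "\<Pi>\<^sub>M a\<in>I - {a}. M"
  interpret PP: product_prob_space "\<lambda>_::'i. M" I
    by unfold_locales
  have ins: "insert a (I - {a}) = I" using assms by blast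
  have [measurable]: "(\<lambda>z. z a) \<in> measurable ?P M"
    using assms by (intro measurable_component_singleton) auto
  note [measurable] = \<Theta>'
  have fubini: "emeasure ?P {z \<in> space ?P. z a \<in> G \<and> T (z a) < t \<and> \<Theta> (T (z a)) z} =
      (\<integral>\<^sup>+x. emeasure M {w \<in> space M. w \<in> G \<and> T w < t \<and> \<Theta> (T w) x} \<partial>?P')"
    if [measurable]: "G \<in> events" for G
  proof -
    let ?S = "{z \<in> space ?P. z a \<in> G \<and> T (z a) < t \<and> \<Theta> (T (z a)) z}"
    have S: "?S \<in> sets ?P" by measurable
    have "emeasure ?P ?S = (\<integral>\<^sup>+z. indicator ?S z \<partial>Pi\<^sub>M (insert a (I - {a})) (\<lambda>_. M))"
      unfolding ins using S by simp
    also have "\<dots> = (\<integral>\<^sup>+x. \<integral>\<^sup>+w. indicator ?S (x(a := w)) \<partial>M \<partial>?P')"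
      using assms(1) S by (intro PP.product_nn_integral_insert) (auto simp: insert_absorb[OF assms(2)])
    also have "\<dots> = (\<integral>\<^sup>+x. \<integral>\<^sup>+w. indicator {w \<in> space M. w \<in> G \<and> T w < t \<and> \<Theta> (T w) x} w \<partial>M \<partial>?P')"
    proof (intro nn_integral_cong)
      fix x w assume x: "x \<in> space ?P'" and w: "w \<in> space M"
      then have "x(a := w) \<in> space ?P"
        using PiE_fun_upd[of w "\<lambda>_. space M" a x "I - {a}"] by (simp add: space_PiM insert_absorb[OF assms(2)])
      with w show "indicator ?S (x(a := w)) =
          (indicator {w \<in> space M. w \<in> G \<and> T w < t \<and> \<Theta> (T w) x} w :: ennreal)"
        by (simp add: indicator_def inv)
    qed
    also have "\<dots> = (\<integral>\<^sup>+x. emeasure M {w \<in> space M. w \<in> G \<and> T w < t \<and> \<Theta> (T w) x} \<partial>?P')"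
    proof (intro nn_integral_cong nn_integral_indicator)
      fix x assume x: "x \<in> space ?P'"
      have "Measurable.pred M (\<lambda>w. \<Theta> (T w) x)"
        using measurable_compose[OF measurable_Pair[OF \<open>random_variable borel T\<close> measurable_const[OF x]] \<Theta>] by simp
      then show "{w \<in> space M. w \<in> G \<and> T w < t \<and> \<Theta> (T w) x} \<in> sets M" by measurable
    qed
    finally show ?thesis .
  qed
  have "ennreal \<delta> * emeasure M {w \<in> space M. w \<in> F \<and> T w < t \<and> \<Theta> (T w) x} \<le>
      emeasure M {w \<in> space M. w \<in> F \<inter> H \<and> T w < t \<and> \<Theta> (T w) x}" if x: "x \<in> space ?P'" for x
  proof -
    \<comment> \<open>This section of \<Theta> is the set \<open>B\<close> to which
      \<open>thin\<close> is applied.\<close>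
    have "{u. \<Theta> u x} \<in> sets borel"
      using measurable_compose[OF measurable_Pair[OF measurable_ident measurable_const[OF x]] \<Theta>]
      by (simp add: pred_def)
    from thin[OF this] \<open>\<delta> \<ge> 0\<close> show ?thesis
      by (simp add: emeasure_eq_measure ennreal_mult[symmetric] conj_ac)
  qed
  then have "(\<integral>\<^sup>+x. ennreal \<delta> * emeasure M {w \<in> space M. w \<in> F \<and> T w < t \<and> \<Theta> (T w) x} \<partial>?P') \<le>
      (\<integral>\<^sup>+x. emeasure M {w \<in> space M. w \<in> F \<inter> H \<and> T w < t \<and> \<Theta> (T w) x} \<partial>?P')"
    by (intro nn_integral_mono) simp
  also have "(\<integral>\<^sup>+x. ennreal \<delta> * emeasure M {w \<in> space M. w \<in> F \<and> T w < t \<and> \<Theta> (T w) x} \<partial>?P') =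
      ennreal \<delta> * (\<integral>\<^sup>+x. emeasure M {w \<in> space M. w \<in> F \<and> T w < t \<and> \<Theta> (T w) x} \<partial>?P')"
  proof (rule nn_integral_cmult)
    have "(\<lambda>p. (T (snd p), fst p)) \<in> measurable (?P' \<Otimes>\<^sub>M M) (borel \<Otimes>\<^sub>M ?P')" by measurable
    from measurable_compose[OF this \<Theta>]
    have [measurable]: "Measurable.pred (?P' \<Otimes>\<^sub>M M) (\<lambda>p. \<Theta> (T (snd p)) (fst p))" by simp
    show "(\<lambda>x. emeasure M {w \<in> space M. w \<in> F \<and> T w < t \<and> \<Theta> (T w) x}) \<in> borel_measurable ?P'"
      by measurable
  qed
  finally have "ennreal \<delta> * emeasure ?P {z \<in> space ?P. z a \<in> F \<and> T (z a) < t \<and> \<Theta> (T (z a)) z} \<le>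
      emeasure ?P {z \<in> space ?P. z a \<in> F \<inter> H \<and> T (z a) < t \<and> \<Theta> (T (z a)) z}"
    by (simp only: fubini sets.Int assms)
  then show ?thesis
    using \<open>\<delta> \<ge> 0\<close> by (simp add: PP.P.emeasure_eq_measure ennreal_mult[symmetric])
qed

text \<open>Split by the exact set of coordinates in \<open>E\<close>. One such coordinate
  contributes at least its share \<delta>. Two contribute at least the fraction
  \<open>2 * \<delta> - \<delta>\<^sup>2\<close>, and by hypothesis the surplus
  \<open>\<delta> * (1 - \<delta>)\<close> pays for the patterns with none.\<close>

lemma prob_PiM_few:
  fixes \<delta> :: real
  assumes I: "finite I" "card I \<ge> 2" and [measurable]: "E \<in> events" "H \<in> events"
    and \<delta>: "\<delta> * prob E \<le> prob (E \<inter> H)" "\<delta> \<ge> 0" "\<delta> \<le> 1"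
    and E: "(1 - prob E)\<^sup>2 \<le> (1 - \<delta>) * (real (card I choose 2) * (prob E)\<^sup>2)"
  shows "\<delta> * measure (\<Pi>\<^sub>M a\<in>I. M) {z \<in> space (\<Pi>\<^sub>M a\<in>I. M). card {a \<in> I. z a \<in> E} \<le> 2} \<le>
    measure (\<Pi>\<^sub>M a\<in>I. M) {z \<in> space (\<Pi>\<^sub>M a\<in>I. M). card {a \<in> I. z a \<in> E} \<le> 2 \<and> (\<exists>a\<in>I. z a \<in> E \<inter> H)}"
proof -
  let ?P = "\<Pi>\<^sub>M a\<in>I. M" and ?p = "prob E" and ?h = "prob (E \<inter> H)" and ?d = "card I"
  interpret PP: finite_product_prob_space "\<lambda>_. M" I
    by unfold_locales (fact I)
  have comp [measurable]: "(\<lambda>z. z a) \<in> measurable ?P M" if "a \<in> I" for a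
    using that by (intro measurable_component_singleton) auto
  \<comment> \<open>In \<open>?A J\<close> the coordinates in \<open>E\<close> are exactly those of
    \<open>J\<close>; in \<open>?N J\<close> moreover none of them lies in \<open>H\<close>. The
    favourable event is the disjoint union of the differences.\<close>
  let ?A = "\<lambda>J. {z \<in> space ?P. (\<forall>a\<in>J. z a \<in> E) \<and> (\<forall>a\<in>I - J. z a \<notin> E)}"
  let ?N = "\<lambda>J. {z \<in> space ?P. (\<forall>a\<in>J. z a \<in> E - H) \<and> (\<forall>a\<in>I - J. z a \<notin> E)}"
  let ?S = "{J. J \<subseteq> I \<and> card J \<le> 2}"
  have finS: "finite ?S" using I by simp
  have finJ: "finite J" if "J \<in> ?S" for J using that I finite_subset by auto
  have A: "?A J \<in> sets ?P" and N: "?N J \<in> sets ?P" if "J \<in> ?S" for J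
  proof -
    have *: "{z \<in> space ?P. z a \<in> G} \<in> sets ?P" if "G \<in> events" "a \<in> I" for a G
      using that by measurable
    have "a \<in> I" if "a \<in> J" for a using that \<open>J \<in> ?S\<close> by blast
    then show "?A J \<in> sets ?P" "?N J \<in> sets ?P"
      using I finJ[OF that] * by (auto intro!: sets.sets_Collect sets.sets_Collect_finite_All')
  qed
  have A_eq: "?A J = {z \<in> space ?P. {a \<in> I. z a \<in> E} = J}" if "J \<in> ?S" for J
    using that by blast
  have disjA: "disjoint_family_on ?A ?S"
    unfolding disjoint_family_on_def using A_eq by blast
  have disjAN: "disjoint_family_on (\<lambda>J. ?A J - ?N J) ?S"
    by (rule disjoint_family_on_bisimulation[OF disjA]) blast
  have AN: "?A J - ?N J \<in> sets ?P" if "J \<in> ?S" for J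
    using A[OF that] N[OF that] by (rule sets.Diff)
  have pA: "measure ?P (?A J) = ?p ^ card J * (1 - ?p) ^ (?d - card J)" if "J \<in> ?S" for J
    using that I by (intro prob_PiM_pattern) auto
  have pN: "measure ?P (?N J) = (?p - ?h) ^ card J * (1 - ?p) ^ (?d - card J)" if "J \<in> ?S" for J
  proof -
    have "prob (E - H) = ?p - ?h" by (rule finite_measure_Diff') measurable
    then show ?thesis using that I by (subst prob_PiM_pattern) auto
  qed
  have "{z \<in> space ?P. card {a \<in> I. z a \<in> E} \<le> 2} = (\<Union>J\<in>?S. ?A J)"
    using A_eq by auto
  then have "measure ?P {z \<in> space ?P. card {a \<in> I. z a \<in> E} \<le> 2} = (\<Sum>J\<in>?S. measure ?P (?A J))"
    using A finS disjA by (simp only:) (intro PP.finite_measure_finite_Union, blast+)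
  also have "\<dots> = (\<Sum>J\<in>?S. ?p ^ card J * (1 - ?p) ^ (?d - card J))"
    using pA by (intro sum.cong refl) auto
  also have "\<dots> = (1 - ?p) ^ ?d + ?d * (?p * (1 - ?p) ^ (?d - 1)) +
      (?d choose 2) * (?p ^ 2 * (1 - ?p) ^ (?d - 2))"
    by (subst sum_subsets_card_le_2[OF I(1), of "\<lambda>j. ?p ^ j * (1 - ?p) ^ (?d - j)"]) simp
  finally have few: "measure ?P {z \<in> space ?P. card {a \<in> I. z a \<in> E} \<le> 2} =
      (1 - ?p) ^ ?d + ?d * (?p * (1 - ?p) ^ (?d - 1)) + (?d choose 2) * (?p ^ 2 * (1 - ?p) ^ (?d - 2))" .
  have "{z \<in> space ?P. card {a \<in> I. z a \<in> E} \<le> 2 \<and> (\<exists>a\<in>I. z a \<in> E \<inter> H)} = (\<Union>J\<in>?S. ?A J - ?N J)"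
  proof (intro equalityI subsetI)
    fix z assume z: "z \<in> {z \<in> space ?P. card {a \<in> I. z a \<in> E} \<le> 2 \<and> (\<exists>a\<in>I. z a \<in> E \<inter> H)}"
    let ?J = "{a \<in> I. z a \<in> E}"
    have "?J \<in> ?S" "z \<in> ?A ?J" "z \<notin> ?N ?J" using z by auto
    then show "z \<in> (\<Union>J\<in>?S. ?A J - ?N J)" by blast
  next
    fix z assume "z \<in> (\<Union>J\<in>?S. ?A J - ?N J)"
    then obtain J where J: "J \<in> ?S" "z \<in> ?A J" "z \<notin> ?N J" by blast
    then have "z \<in> space ?P" "{a \<in> I. z a \<in> E} = J" "\<exists>a\<in>J. z a \<in> H" by auto
    with J(1) show "z \<in> {z \<in> space ?P. card {a \<in> I. z a \<in> E} \<le> 2 \<and> (\<exists>a\<in>I. z a \<in> E \<inter> H)}"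
      by auto
  qed
  then have "measure ?P {z \<in> space ?P. card {a \<in> I. z a \<in> E} \<le> 2 \<and> (\<exists>a\<in>I. z a \<in> E \<inter> H)} =
      (\<Sum>J\<in>?S. measure ?P (?A J - ?N J))"
    using AN finS disjAN by (simp only:) (intro PP.finite_measure_finite_Union, blast+)
  also have "\<dots> = (\<Sum>J\<in>?S. (?p ^ card J - (?p - ?h) ^ card J) * (1 - ?p) ^ (?d - card J))"
  proof (intro sum.cong refl)
    fix J assume J: "J \<in> ?S"
    have "measure ?P (?A J - ?N J) = measure ?P (?A J) - measure ?P (?N J)"
      using A[OF J] N[OF J] by (intro PP.finite_measure_Diff) auto
    then show "measure ?P (?A J - ?N J) = (?p ^ card J - (?p - ?h) ^ card J) * (1 - ?p) ^ (?d - card J)"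
      unfolding pA[OF J] pN[OF J] by (simp only: left_diff_distrib)
  qed
  also have "\<dots> = ?d * (?h * (1 - ?p) ^ (?d - 1)) +
      (?d choose 2) * ((?p ^ 2 - (?p - ?h) ^ 2) * (1 - ?p) ^ (?d - 2))"
    by (subst sum_subsets_card_le_2[OF I(1), of "\<lambda>j. (?p ^ j - (?p - ?h) ^ j) * (1 - ?p) ^ (?d - j)"]) simp
  finally have good: "measure ?P {z \<in> space ?P. card {a \<in> I. z a \<in> E} \<le> 2 \<and> (\<exists>a\<in>I. z a \<in> E \<inter> H)} =
      ?d * (?h * (1 - ?p) ^ (?d - 1)) + (?d choose 2) * ((?p ^ 2 - (?p - ?h) ^ 2) * (1 - ?p) ^ (?d - 2))" .
  have p1: "0 \<le> 1 - ?p" by simp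
  have hp: "?h \<le> ?p" by (intro finite_measure_mono) auto
  \<comment> \<open>This bounds the chance that both of two coordinates lie in \<open>E\<close> but
    outside \<open>H\<close>.\<close>
  have "(?p - ?h) ^ 2 \<le> ((1 - \<delta>) * ?p) ^ 2"
    using \<delta> hp by (intro power_mono) (auto simp: algebra_simps)
  then have sq: "(2 * \<delta> - \<delta>\<^sup>2) * ?p\<^sup>2 \<le> ?p ^ 2 - (?p - ?h) ^ 2"
    by (simp add: power2_eq_square algebra_simps)
  let ?x = "(1 - ?p) ^ (?d - 2)" and ?C = "real (?d choose 2)"
  have "?d = (?d - 2) + 2" using I by simp
  then have "(1 - ?p) ^ ?d = ?x * (1 - ?p)\<^sup>2" by (metis power_add)
  then have "\<delta> * ((1 - ?p) ^ ?d + ?C * (?p ^ 2 * ?x)) = \<delta> * ((1 - ?p)\<^sup>2 + ?C * ?p\<^sup>2) * ?x"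
    by (simp add: algebra_simps)
  also have "\<dots> \<le> (?C * ((2 * \<delta> - \<delta>\<^sup>2) * ?p\<^sup>2)) * ?x"
  proof (rule mult_right_mono)
    have "\<delta> * (1 - ?p)\<^sup>2 \<le> \<delta> * ((1 - \<delta>) * (?C * ?p\<^sup>2))"
      by (rule mult_left_mono[OF E \<open>\<delta> \<ge> 0\<close>])
    then show "\<delta> * ((1 - ?p)\<^sup>2 + ?C * ?p\<^sup>2) \<le> ?C * ((2 * \<delta> - \<delta>\<^sup>2) * ?p\<^sup>2)"
      by (simp add: algebra_simps power2_eq_square)
  qed simp
  also have "\<dots> \<le> ?C * (?p ^ 2 - (?p - ?h) ^ 2) * ?x"
    using sq by (intro mult_right_mono mult_left_mono) auto
  finally have "\<delta> * ((1 - ?p) ^ ?d + ?C * (?p ^ 2 * ?x)) \<le> ?C * (?p ^ 2 - (?p - ?h) ^ 2) * ?x" .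
  moreover have "(\<delta> * ?p) * (?d * (1 - ?p) ^ (?d - 1)) \<le> ?h * (?d * (1 - ?p) ^ (?d - 1))"
    using \<delta> by (intro mult_right_mono) auto
  ultimately show ?thesis
    unfolding few good by (simp add: algebra_simps)
qed

text \<open>
  In the next lemma \<open>M\<close> is the law of a subtree, \<open>F\<close> says that the edge above it is effective, \<open>T\<close> is
  the clock of that edge and \<open>H\<close> says that the subtree survives for \<open>n\<close> generations; \<open>z a\<close> is
  the subtree of the \<open>a\<close>-th child. In the proof, \<open>lead\<close> singles out the earliest effective child,
  ties being broken by index.
\<close>

lemma survival_step:
  fixes T :: "'a \<Rightarrow> real" and I :: "nat set"
  assumes I: "finite I" "card I \<ge> 2" and meas [measurable]: "F \<in> events" "H \<in> events" "random_variable borel T"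
    and thin: "\<And>B. B \<in> sets borel \<Longrightarrow>
      \<delta> * prob {w \<in> space M. w \<in> F \<and> T w < t \<and> T w \<in> B} \<le> prob {w \<in> space M. w \<in> F \<and> w \<in> H \<and> T w < t \<and> T w \<in> B}"
    and \<delta>: "\<delta> \<ge> 0" "\<delta> \<le> 1" and st: "s \<le> t"
    and p: "p = prob {w \<in> space M. w \<in> F \<and> T w < t}" "(1 - p)\<^sup>2 \<le> (1 - \<delta>) * (real (card I choose 2) * p\<^sup>2)"
  shows "\<delta> * measure (\<Pi>\<^sub>M a\<in>I. M) {z \<in> space (\<Pi>\<^sub>M a\<in>I. M). card {a \<in> I. z a \<in> F \<and> T (z a) < s} \<le> 2} \<le>
    measure (\<Pi>\<^sub>M a\<in>I. M) {z \<in> space (\<Pi>\<^sub>M a\<in>I. M). card {a \<in> I. z a \<in> F \<and> T (z a) < s} \<le> 2 \<and>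
      (\<exists>a\<in>I. z a \<in> F \<and> z a \<in> H \<and> T (z a) < t \<and> card {b \<in> I. z b \<in> F \<and> T (z b) < T (z a)} \<le> 1)}"
proof -
  let ?P = "\<Pi>\<^sub>M a\<in>I. M"
  interpret PP: finite_product_prob_space "\<lambda>_::nat. M" I
    by unfold_locales (fact I)
  have comp [measurable]: "(\<lambda>z. z a) \<in> measurable ?P M" if "a \<in> I" for a
    using that by (intro measurable_component_singleton) auto
  define N where "N r z = {a \<in> I. z a \<in> F \<and> T (z a) < r}" for r z
  have finN: "finite (N r z)" for r z using I by (simp add: N_def)
  define lead where "lead a z \<longleftrightarrow> (\<forall>b\<in>I - {a}. z b \<in> F \<longrightarrow> T (z a) \<le> T (z b) \<and> (b < a \<longrightarrow> T (z a) \<noteq> T (z b)))" for a z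
  \<comment> \<open>For an effective child \<open>a\<close> with clock \<open>u < t\<close>, this
    says that \<open>a\<close> leads, at least three children are effective before \<open>t\<close>
    and at most two before \<open>s\<close>, in terms of \<open>u\<close> and the other coordinates
    alone. Child \<open>a\<close> is the third one, which explains the 2; it uses up a place before
    \<open>s\<close> if \<open>u < s\<close>, which explains the 1.\<close>
  define \<Theta> where "\<Theta> a u z \<longleftrightarrow> 2 \<le> card {b \<in> I - {a}. z b \<in> F \<and> T (z b) < t} \<and>
    card {b \<in> I - {a}. z b \<in> F \<and> T (z b) < s} \<le> 2 \<and>
    (u < s \<longrightarrow> card {b \<in> I - {a}. z b \<in> F \<and> T (z b) < s} \<le> 1) \<and>
    (\<forall>b\<in>I - {a}. z b \<in> F \<longrightarrow> u \<le> T (z b) \<and> (b < a \<longrightarrow> u \<noteq> T (z b)))" for a u z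
  \<comment> \<open>Stated over a general space since it is needed both with \<open>u\<close> a free
    coordinate and with \<open>u\<close> the clock of child \<open>a\<close>.\<close>
  have \<Theta>_pred: "Measurable.pred L (\<lambda>x. \<Theta> a (u x) (z x))"
    if [measurable]: "u \<in> borel_measurable L" and z: "z \<in> measurable L (\<Pi>\<^sub>M b\<in>J. M)" and J: "I - {a} \<subseteq> J"
    for L a u J and z :: "'b \<Rightarrow> nat \<Rightarrow> 'a"
  proof -
    have [measurable]: "(\<lambda>x. z x b) \<in> measurable L M" if "b \<in> I - {a}" for b
      using that J z by (intro measurable_compose[OF z measurable_component_singleton]) auto
    have [measurable]: "(\<lambda>x. card {b \<in> I - {a}. z x b \<in> F \<and> T (z x b) < r}) \<in> measurable L (count_space UNIV)" for r
      by (intro measurable_card_filter) measurable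
    have fin: "finite (I - {a})" using I by simp
    have "Measurable.pred L (\<lambda>x. \<forall>b\<in>I - {a}. z x b \<in> F \<longrightarrow> u x \<le> T (z x b) \<and> (b < a \<longrightarrow> u x \<noteq> T (z x b)))"
      by (rule pred_intros_finite(3)[OF fin]) measurable
    moreover have "Measurable.pred L (\<lambda>x. 2 \<le> card {b \<in> I - {a}. z x b \<in> F \<and> T (z x b) < t})"
      by measurable
    moreover have "Measurable.pred L (\<lambda>x. card {b \<in> I - {a}. z x b \<in> F \<and> T (z x b) < s} \<le> 2)"
      by measurable
    moreover have "Measurable.pred L (\<lambda>x. u x < s \<longrightarrow> card {b \<in> I - {a}. z x b \<in> F \<and> T (z x b) < s} \<le> 1)"
      by measurable
    ultimately show ?thesis unfolding \<Theta>_def by (intro pred_intros_logic(3))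
  qed
  have card_N: "card (N r z) = card {b \<in> I - {a}. z b \<in> F \<and> T (z b) < r} + (if z a \<in> F \<and> T (z a) < r then 1 else 0)"
    if "a \<in> I" for a r z
  proof -
    have "N r z = {b \<in> I - {a}. z b \<in> F \<and> T (z b) < r} \<union> (if z a \<in> F \<and> T (z a) < r then {a} else {})"
      using that by (auto simp: N_def)
    then show ?thesis using I by (simp add: card_insert_if)
  qed
  have \<Theta>_iff: "z a \<in> F \<and> T (z a) < t \<and> \<Theta> a (T (z a)) z \<longleftrightarrow>
      a \<in> N t z \<and> lead a z \<and> 3 \<le> card (N t z) \<and> card (N s z) \<le> 2" if "a \<in> I" for a z
    unfolding card_N[OF that] \<Theta>_def lead_def using that by (auto simp: N_def)
  let ?B = "\<lambda>a. {z \<in> space ?P. z a \<in> F \<and> T (z a) < t \<and> \<Theta> a (T (z a)) z}"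
  let ?BH = "\<lambda>a. {z \<in> space ?P. z a \<in> F \<and> z a \<in> H \<and> T (z a) < t \<and> \<Theta> a (T (z a)) z}"
  let ?Few = "{z \<in> space ?P. card (N t z) \<le> 2}"
  let ?FewH = "{z \<in> space ?P. card (N t z) \<le> 2 \<and> (\<exists>a\<in>I. z a \<in> F \<and> T (z a) < t \<and> z a \<in> H)}"
  have \<Theta>1 [measurable]: "Measurable.pred ?P (\<lambda>z. \<Theta> a (T (z a)) z)" if [measurable]: "a \<in> I" for a
    by (rule \<Theta>_pred[OF _ measurable_ident_sets[OF refl]]) auto
  have B: "?B a \<in> sets ?P" "?BH a \<in> sets ?P" if [measurable]: "a \<in> I" for a by measurable
  have N_meas [measurable]: "(\<lambda>z. card (N r z)) \<in> measurable ?P (count_space UNIV)" for r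
    unfolding N_def by (intro measurable_card_filter) measurable
  have Few: "?Few \<in> sets ?P" "?FewH \<in> sets ?P"
    using I by measurable
  have disj: "disjoint_family_on ?B I"
  proof (unfold disjoint_family_on_def, intro ballI impI)
    fix a b assume ab: "a \<in> I" "b \<in> I" "a \<noteq> b"
    have False if ld: "lead a z" "lead b z" and N: "a \<in> N t z" "b \<in> N t z" for z
    proof -
      have *: "a \<in> I - {b}" "b \<in> I - {a}" "z a \<in> F" "z b \<in> F" using ab N by (auto simp: N_def)
      have "T (z a) \<le> T (z b) \<and> (b < a \<longrightarrow> T (z a) \<noteq> T (z b))" using ld(1) *(2,4) unfolding lead_def by blast
      moreover have "T (z b) \<le> T (z a) \<and> (a < b \<longrightarrow> T (z b) \<noteq> T (z a))" using ld(2) *(1,3) unfolding lead_def by blast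
      ultimately show False using ab(3) by linarith
    qed
    then show "?B a \<inter> ?B b = {}" using \<Theta>_iff ab by blast
  qed
  have dFew: "?Few \<inter> (\<Union>a\<in>I. ?B a) = {}"
  proof -
    have False if "z \<in> ?Few" "a \<in> I" "z \<in> ?B a" for a z
      using that \<Theta>_iff[of a z] by simp
    then show ?thesis by blast
  qed
  have BHB: "?BH a \<subseteq> ?B a" for a by blast
  have lead_ex: "\<exists>a\<in>N t z. lead a z" if ne: "N t z \<noteq> {}" for z
  proof -
    define S where "S = {a \<in> N t z. \<forall>b\<in>N t z. T (z a) \<le> T (z b)}"
    have finS: "finite S" using finN by (simp add: S_def)
    have "arg_min_on (\<lambda>a. T (z a)) (N t z) \<in> S"
      unfolding S_def using arg_min_least[OF finN ne, where f = "\<lambda>a. T (z a)"]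
        arg_min_if_finite(1)[OF finN ne, where f = "\<lambda>a. T (z a)"] by blast
    then have "Min S \<in> S" using finS by (intro Min_in) auto
    then have S: "Min S \<in> N t z" "\<And>b. b \<in> N t z \<Longrightarrow> T (z (Min S)) \<le> T (z b)" by (auto simp: S_def)
    have "lead (Min S) z"
      unfolding lead_def
    proof (intro ballI impI)
      fix b assume b: "b \<in> I - {Min S}" "z b \<in> F"
      show "T (z (Min S)) \<le> T (z b) \<and> (b < Min S \<longrightarrow> T (z (Min S)) \<noteq> T (z b))"
      proof (cases "b \<in> N t z")
        case True
        moreover have False if "b < Min S" "T (z (Min S)) = T (z b)"
        proof -
          have "b \<in> S" using True S(2) that(2) by (simp add: S_def)
          then have "Min S \<le> b" using finS by simp
          with that show False by simp
        qed
        ultimately show ?thesis using S(2) by blast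
      next
        case False
        then show ?thesis using b S(1) by (auto simp: N_def)
      qed
    qed
    with S(1) show ?thesis by blast
  qed
  have N_mono: "N s z \<subseteq> N t z" for z using st by (auto simp: N_def)
  \<comment> \<open>Availability at \<open>s\<close> is split by the count before \<open>t\<close>:
    at most two, which suffices because \<open>s \<le> t\<close>, or at least three, with a unique
    leader. The first case is handled by \<open>prob_PiM_few\<close>, each leader by
    \<open>PiM_thinning\<close>.\<close>
  have "{z \<in> space ?P. card (N s z) \<le> 2} = ?Few \<union> (\<Union>a\<in>I. ?B a)"
  proof (intro equalityI subsetI)
    fix z assume z: "z \<in> {z \<in> space ?P. card (N s z) \<le> 2}"
    show "z \<in> ?Few \<union> (\<Union>a\<in>I. ?B a)"
    proof (cases "card (N t z) \<le> 2")
      case False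
      then have "N t z \<noteq> {}" by auto
      then obtain a where a: "a \<in> N t z" "lead a z" using lead_ex by blast
      then have "a \<in> I" by (simp add: N_def)
      with a False z have "z \<in> ?B a" using \<Theta>_iff[of a z] by simp
      with \<open>a \<in> I\<close> show ?thesis by blast
    qed (use z in simp)
  next
    fix z assume "z \<in> ?Few \<union> (\<Union>a\<in>I. ?B a)"
    then show "z \<in> {z \<in> space ?P. card (N s z) \<le> 2}"
    proof
      assume "z \<in> ?Few"
      then show ?thesis using card_mono[OF finN N_mono, of z] by simp
    next
      assume "z \<in> (\<Union>a\<in>I. ?B a)"
      then show ?thesis using \<Theta>_iff by blast
    qed
  qed
  then have "\<delta> * measure ?P {z \<in> space ?P. card (N s z) \<le> 2} = \<delta> * measure ?P ?Few + (\<Sum>a\<in>I. \<delta> * measure ?P (?B a))"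
    using B Few dFew disj I
    by (simp add: PP.finite_measure_Union PP.finite_measure_finite_Union sets.finite_UN image_subset_iff
        distrib_left sum_distrib_left)
  also have "\<dots> \<le> measure ?P ?FewH + (\<Sum>a\<in>I. measure ?P (?BH a))"
  proof (intro add_mono sum_mono)
    let ?E = "{w \<in> space M. w \<in> F \<and> T w < t}"
    have E: "?E \<in> events" by measurable
    have EH: "?E \<inter> H = {w \<in> space M. w \<in> F \<and> w \<in> H \<and> T w < t \<and> T w \<in> UNIV}" by blast
    have zE: "z a \<in> ?E \<longleftrightarrow> z a \<in> F \<and> T (z a) < t" if "a \<in> I" "z \<in> space ?P" for z a
      using that by (auto simp: space_PiM)
    have "?Few = {z \<in> space ?P. card {a \<in> I. z a \<in> ?E} \<le> 2}"
      "?FewH = {z \<in> space ?P. card {a \<in> I. z a \<in> ?E} \<le> 2 \<and> (\<exists>a\<in>I. z a \<in> ?E \<inter> H)}"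
      using zE by (auto simp: N_def cong: conj_cong)
    moreover have "\<delta> * prob ?E \<le> prob (?E \<inter> H)"
      using thin[of UNIV] unfolding EH by simp
    ultimately show "\<delta> * measure ?P ?Few \<le> measure ?P ?FewH"
      using prob_PiM_few[OF I E meas(2) _ \<delta>] p by simp
  next
    fix a assume a: "a \<in> I"
    show "\<delta> * measure ?P (?B a) \<le> measure ?P (?BH a)"
    proof (rule PiM_thinning[OF I(1) a meas thin \<delta>(1)])
      show "\<Theta> a u (z(a := y)) = \<Theta> a u z" for u z y
        unfolding \<Theta>_def by (auto cong: conj_cong)
      show "Measurable.pred (borel \<Otimes>\<^sub>M Pi\<^sub>M (I - {a}) (\<lambda>a. M)) (\<lambda>p. \<Theta> a (fst p) (snd p))"
        by (rule \<Theta>_pred[OF measurable_fst measurable_snd]) simp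
    qed (use \<Theta>1[OF a] in auto)
  qed
  also have "\<dots> = measure ?P (?FewH \<union> (\<Union>a\<in>I. ?BH a))"
  proof -
    have "disjoint_family_on ?BH I"
      by (rule disjoint_family_on_bisimulation[OF disj]) blast
    moreover have "?FewH \<inter> (\<Union>a\<in>I. ?BH a) = {}" using dFew by blast
    ultimately show ?thesis using B Few I
      by (simp add: PP.finite_measure_Union PP.finite_measure_finite_Union sets.finite_UN image_subset_iff)
  qed
  also have "\<dots> \<le> measure ?P {z \<in> space ?P. card (N s z) \<le> 2 \<and>
      (\<exists>a\<in>I. z a \<in> F \<and> z a \<in> H \<and> T (z a) < t \<and> card {b \<in> I. z b \<in> F \<and> T (z b) < T (z a)} \<le> 1)}"
  proof (rule PP.finite_measure_mono)
    show "?FewH \<union> (\<Union>a\<in>I. ?BH a) \<subseteq> {z \<in> space ?P. card (N s z) \<le> 2 \<and>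
      (\<exists>a\<in>I. z a \<in> F \<and> z a \<in> H \<and> T (z a) < t \<and> card {b \<in> I. z b \<in> F \<and> T (z b) < T (z a)} \<le> 1)}"
      (is "_ \<subseteq> ?G")
    proof
      fix z assume "z \<in> ?FewH \<union> (\<Union>a\<in>I. ?BH a)"
      then show "z \<in> ?G"
      proof
        assume z: "z \<in> ?FewH"
        then obtain a where a: "a \<in> I" "z a \<in> F" "T (z a) < t" "z a \<in> H" by blast
        \<comment> \<open>The inclusion is strict because \<open>a\<close> is missing on the left,
          so at most one effective child precedes \<open>a\<close>.\<close>
        then have "{b \<in> I. z b \<in> F \<and> T (z b) < T (z a)} \<subset> N t z" by (auto simp: N_def)
        then have "card {b \<in> I. z b \<in> F \<and> T (z b) < T (z a)} < card (N t z)"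
          by (rule psubset_card_mono[OF finN])
        then show ?thesis using z a card_mono[OF finN N_mono, of z] by auto
      next
        assume "z \<in> (\<Union>a\<in>I. ?BH a)"
        then obtain a where a: "a \<in> I" "z \<in> ?BH a" by blast
        then have "lead a z" "card (N s z) \<le> 2" using \<Theta>_iff[OF a(1), of z] by auto
        then have "{b \<in> I. z b \<in> F \<and> T (z b) < T (z a)} = {}" unfolding lead_def by force
        then have "card {b \<in> I. z b \<in> F \<and> T (z b) < T (z a)} \<le> 1" by (simp only: card.empty)
        then show ?thesis using a \<open>card (N s z) \<le> 2\<close> by blast
      qed
    qed
    have [measurable]: "(\<lambda>z. card {b \<in> I. z b \<in> F \<and> T (z b) < T (z a)}) \<in> measurable ?P (count_space UNIV)"
      if "a \<in> I" for a
      using that by (intro measurable_card_filter) measurable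
    show "?G \<in> sets ?P" using I by measurable
  qed
  finally show ?thesis unfolding N_def .
qed

end

section \<open>Survival of the branching process\<close>

text \<open>Only \<open>effective\<close> reads the phantom clock \<open>W []\<close>; availability
  and lineages do not. This is what allows the root clock to be resampled independently.\<close>

lemma avail_approx_root_clock: "avail_approx d n s (W([] := u)) = avail_approx d n s W"
  by (cases n) simp_all

lemma avail_root_clock: "avail d s (W([] := u)) = avail d s W"
  unfolding avail_def avail_approx_root_clock ..

lemma lineage_root_clock: "lineage d t n (W([] := u)) = lineage d t n W"
  by (cases n) simp_all

lemma lineage_Suc: "lineage d t (Suc n) W \<Longrightarrow> lineage d t n W"
proof (induction n arbitrary: W)
  case (Suc n)
  from Suc.prems obtain a where "a \<in> {1..d}" "W [a] < t" "effective d (\<lambda>y. W (a # y))"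
    "card {b \<in> {1..d}. effective d (\<lambda>y. W (b # y)) \<and> W [b] < W [a]} \<le> 1"
    "lineage d t (Suc n) (\<lambda>y. W (a # y))"
    unfolding lineage.simps(2)[of d t "Suc n"] by blast
  moreover from this(5) have "lineage d t n (\<lambda>y. W (a # y))" by (rule Suc.IH)
  ultimately show ?case unfolding lineage.simps(2) by (intro bexI[of _ a] conjI)
qed simp

context
  fixes d :: nat
begin

section \<open>The law of the clocks: self-similarity, independent subtrees, measurability\<close>

definition word_clocks :: "(nat list \<Rightarrow> real) measure" where
  "word_clocks = (\<Pi>\<^sub>M x\<in>tree_vertices d. unit_clock)"

interpretation word_clocks: prob_space word_clocks
  unfolding word_clocks_def by (intro prob_space_PiM prob_space_unit_clock)

lemma clock_in_unit_interval: "W \<in> space word_clocks \<Longrightarrow> x \<in> tree_vertices d \<Longrightarrow> W x \<in> {0..1}"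
  by (auto simp: word_clocks_def space_PiM space_restrict_space PiE_iff)

lemma measurable_word_clock [measurable]:
  assumes "x \<in> tree_vertices d"
  shows "(\<lambda>W. W x) \<in> borel_measurable word_clocks"
proof -
  have "(\<lambda>u. u) \<in> borel_measurable unit_clock"
    by (intro measurable_restrict_space1) simp
  from measurable_compose[OF measurable_component_singleton[OF assms] this]
  show ?thesis by (simp add: word_clocks_def)
qed

text \<open>Edges correspond injectively to nonempty words, so \<open>edge_clocks\<close> merely
  reindexes a subfamily of the independent clocks.\<close>

lemma distr_edge_clocks:
  "edge_clocks d \<in> measurable word_clocks (clock_measure (tree_edges d))"
  "distr word_clocks (clock_measure (tree_edges d)) (edge_clocks d) = clock_measure (tree_edges d)"
proof -
  let ?f = "inv_into {x. x \<noteq> []} edge_to"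
  have f: "?f \<in> tree_edges d \<rightarrow> tree_vertices d"
  proof
    fix e assume "e \<in> tree_edges d"
    then obtain x where "x \<in> tree_vertices d" "x \<noteq> []" "e = edge_to x" by (rule tree_edge_cases)
    then show "?f e \<in> tree_vertices d" by (simp add: inv_into_f_f[OF inj_on_edge_to])
  qed
  have "inj_on ?f (tree_edges d)"
    by (rule inj_on_inv_into) (auto simp: tree_edges_eq)
  from distr_PiM_reindex[OF _ this f, of "\<lambda>_. unit_clock"] prob_space_unit_clock
  show "distr word_clocks (clock_measure (tree_edges d)) (edge_clocks d) = clock_measure (tree_edges d)"
    by (simp add: clock_measure_def word_clocks_def edge_clocks_def[abs_def])
  show "edge_clocks d \<in> measurable word_clocks (clock_measure (tree_edges d))"
    unfolding clock_measure_def word_clocks_def edge_clocks_def[abs_def]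
    using f by (intro measurable_restrict measurable_component_singleton) auto
qed

lemma AE_wf_earlier_edge_clocks:
  "AE W in word_clocks. wf (earlier (tree_edges d) (edge_clocks d W))"
proof (rule AE_distrD[OF distr_edge_clocks(1)])
  show "AE U in distr word_clocks (clock_measure (tree_edges d)) (edge_clocks d). wf (earlier (tree_edges d) U)"
    unfolding distr_edge_clocks(2) by (rule AE_wf_earlier_tree)
qed

lemma Cons_in_tree_vertices: "a # y \<in> tree_vertices d \<longleftrightarrow> a \<in> {1..d} \<and> y \<in> tree_vertices d"
  by (auto simp: tree_vertices_def)

text \<open>Points of the product space are \<open>undefined\<close> off the tree, and so are their
  shifts. The restricted form suits the theorems on product measures, the plain form the
  recursions.\<close>

lemma restrict_subtree_clocks:
  assumes "W \<in> space word_clocks" "a \<in> {1..d}"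
  shows "(\<lambda>y\<in>tree_vertices d. W (a # y)) = (\<lambda>y. W (a # y))"
  using assms by (auto simp: word_clocks_def space_PiM PiE_iff extensional_def Cons_in_tree_vertices restrict_def)

lemma measurable_restrict_subtree_clocks:
  "a \<in> {1..d} \<Longrightarrow> (\<lambda>W. \<lambda>y\<in>tree_vertices d. W (a # y)) \<in> measurable word_clocks word_clocks"
  unfolding word_clocks_def
  by (intro measurable_restrict measurable_component_singleton) (simp add: Cons_in_tree_vertices)

lemma measurable_subtree_clocks [measurable]:
  "a \<in> {1..d} \<Longrightarrow> (\<lambda>W y. W (a # y)) \<in> measurable word_clocks word_clocks"
  using measurable_restrict_subtree_clocks[of a] restrict_subtree_clocks
  by (simp cong: measurable_cong_simp)

lemma distr_restrict_subtree_clocks: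
  assumes a: "a \<in> {1..d}"
  shows "distr word_clocks word_clocks (\<lambda>W. \<lambda>y\<in>tree_vertices d. W (a # y)) = word_clocks"
  using distr_PiM_reindex[of "tree_vertices d" "\<lambda>_. unit_clock" "(#) a" "tree_vertices d"] a
  by (simp add: word_clocks_def prob_space_unit_clock Cons_in_tree_vertices)

text \<open>Different subtrees read disjoint blocks \<open>(#) a\<close> applied to the vertices, of
  the independent coordinates.\<close>

lemma indep_vars_restrict_subtree_clocks:
  "word_clocks.indep_vars (\<lambda>_. word_clocks) (\<lambda>a W. \<lambda>y\<in>tree_vertices d. W (a # y)) {1..d}"
proof -
  have "distr word_clocks (Pi\<^sub>M (tree_vertices d) (\<lambda>_. unit_clock)) (\<lambda>W. \<lambda>x\<in>tree_vertices d. W x) =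
      distr word_clocks word_clocks (\<lambda>W. W)"
    by (intro distr_cong refl) (auto simp: word_clocks_def space_PiM)
  also have "\<dots> = (\<Pi>\<^sub>M x\<in>tree_vertices d. distr word_clocks unit_clock (\<lambda>W. W x))"
    unfolding distr_id2[OF refl] unfolding word_clocks_def
    by (intro PiM_cong refl distr_PiM_component[symmetric] prob_space_unit_clock)
  finally have "word_clocks.indep_vars (\<lambda>_. unit_clock) (\<lambda>x W. W x) (tree_vertices d)"
    by (subst word_clocks.indep_vars_iff_distr_eq_PiM')
       (use Nil_in_tree_vertices in \<open>auto simp: word_clocks_def intro: measurable_component_singleton\<close>)
  then have "word_clocks.indep_vars (\<lambda>a. \<Pi>\<^sub>M x\<in>(#) a ` tree_vertices d. unit_clock)
      (\<lambda>a W. \<lambda>x\<in>(#) a ` tree_vertices d. W x) {1..d}"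
    by (rule word_clocks.indep_vars_restrict) (auto simp: Cons_in_tree_vertices disjoint_family_on_def)
  then have "word_clocks.indep_vars (\<lambda>_. word_clocks)
      (\<lambda>a W. (\<lambda>w. \<lambda>y\<in>tree_vertices d. w (a # y)) (\<lambda>x\<in>(#) a ` tree_vertices d. W x)) {1..d}"
  proof (rule word_clocks.indep_vars_compose2)
    show "(\<lambda>w. \<lambda>y\<in>tree_vertices d. w (a # y))
        \<in> measurable (\<Pi>\<^sub>M x\<in>(#) a ` tree_vertices d. unit_clock) word_clocks" for a
      unfolding word_clocks_def by (intro measurable_restrict measurable_component_singleton) simp
  qed
  moreover have "(\<lambda>a W. (\<lambda>w. \<lambda>y\<in>tree_vertices d. w (a # y)) (\<lambda>x\<in>(#) a ` tree_vertices d. W x)) =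
      (\<lambda>a (W :: nat list \<Rightarrow> real). \<lambda>y\<in>tree_vertices d. W (a # y))"
    by (intro ext) (simp add: restrict_def)
  ultimately show ?thesis by simp
qed

text \<open>The branching property: the subtrees of the children are independent copies of the
  whole, each including the clock of the edge above it.\<close>

lemma distr_subtree_clocks:
  assumes "d > 0"
  shows "distr word_clocks (\<Pi>\<^sub>M a\<in>{1..d}. word_clocks) (\<lambda>W. \<lambda>a\<in>{1..d}. \<lambda>y. W (a # y)) =
    (\<Pi>\<^sub>M a\<in>{1..d}. word_clocks)"
proof -
  have "distr word_clocks (\<Pi>\<^sub>M a\<in>{1..d}. word_clocks) (\<lambda>W. \<lambda>a\<in>{1..d}. \<lambda>y. W (a # y)) =
    distr word_clocks (\<Pi>\<^sub>M a\<in>{1..d}. word_clocks) (\<lambda>W. \<lambda>a\<in>{1..d}. \<lambda>y\<in>tree_vertices d. W (a # y))"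
    by (intro distr_cong refl restrict_ext) (simp add: restrict_subtree_clocks)
  also have "\<dots> = (\<Pi>\<^sub>M a\<in>{1..d}. distr word_clocks word_clocks (\<lambda>W. \<lambda>y\<in>tree_vertices d. W (a # y)))"
  proof (rule word_clocks.indep_vars_iff_distr_eq_PiM'[THEN iffD1])
    show "{1..d} \<noteq> {}" using assms by simp
  qed (rule measurable_restrict_subtree_clocks indep_vars_restrict_subtree_clocks; assumption?)+
  also have "\<dots> = (\<Pi>\<^sub>M a\<in>{1..d}. word_clocks)"
    by (intro PiM_cong refl distr_restrict_subtree_clocks)
  finally show ?thesis .
qed

text \<open>The root coordinate is independent of the others, so a fresh uniform value leaves the
  law unchanged.\<close>

lemma distr_resample_root:
  "distr (unit_clock \<Otimes>\<^sub>M word_clocks) word_clocks (\<lambda>(u, W). W([] := u)) = word_clocks"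
proof -
  have "insert [] (tree_vertices d) = tree_vertices d" using Nil_in_tree_vertices by blast
  then show ?thesis
    using distr_pair_PiM_eq_PiM[of "tree_vertices d" "\<lambda>_. unit_clock" "[]"] prob_space_unit_clock
    by (simp add: word_clocks_def)
qed

lemma measurable_resample_root [measurable]:
  "(\<lambda>p. (snd p)([] := fst p)) \<in> measurable (unit_clock \<Otimes>\<^sub>M word_clocks) word_clocks"
proof -
  have "insert [] (tree_vertices d) = tree_vertices d" using Nil_in_tree_vertices by blast
  then show ?thesis
    using measurable_fun_upd[of "tree_vertices d" "tree_vertices d" "[]" snd "unit_clock \<Otimes>\<^sub>M word_clocks" "\<lambda>_. unit_clock" fst]
    unfolding word_clocks_def by (simp add: insert_absorb)
qed

text \<open>Joint measurability in time and clocks is required because the recursion inserts the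
  random time \<open>W [a]\<close>.\<close>

lemma pred_avail_approx:
  "Measurable.pred (borel \<Otimes>\<^sub>M word_clocks) (\<lambda>p. avail_approx d n (fst p) (snd p))"
proof (induction n)
  case (Suc n)
  have "Measurable.pred (borel \<Otimes>\<^sub>M word_clocks) (\<lambda>p. snd p [a] < fst p \<and>
      avail_approx d n (snd p [a]) (\<lambda>y. snd p (a # y)))" if a [measurable]: "a \<in> {1..d}" for a
  proof -
    have [measurable]: "[a] \<in> tree_vertices d" using a by (simp add: tree_vertices_def)
    have "(\<lambda>p. (snd p [a], \<lambda>y. snd p (a # y))) \<in> measurable (borel \<Otimes>\<^sub>M word_clocks) (borel \<Otimes>\<^sub>M word_clocks)"
      by measurable
    from measurable_compose[OF this Suc] have [measurable]:
      "Measurable.pred (borel \<Otimes>\<^sub>M word_clocks) (\<lambda>p. avail_approx d n (snd p [a]) (\<lambda>y. snd p (a # y)))"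
      by simp
    show ?thesis by measurable
  qed
  note [measurable] = measurable_card_filter[OF this]
  show ?case unfolding avail_approx.simps by measurable
qed simp

lemma pred_avail:
  assumes "f \<in> borel_measurable M" "g \<in> measurable M word_clocks"
  shows "Measurable.pred M (\<lambda>x. avail d (f x) (g x))"
proof -
  have [measurable]: "Measurable.pred M (\<lambda>x. avail_approx d n (f x) (g x))" for n
    using measurable_compose[OF measurable_Pair[OF assms] pred_avail_approx[of n]] by simp
  show ?thesis unfolding avail_def by measurable
qed

lemma pred_effective:
  assumes g: "g \<in> measurable M word_clocks"
  shows "Measurable.pred M (\<lambda>x. effective d (g x))"
  unfolding effective_def
  using measurable_compose[OF g measurable_word_clock[OF Nil_in_tree_vertices]] g by (rule pred_avail)

lemma pred_lineage: "Measurable.pred word_clocks (lineage d t n)"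
proof (induction n)
  case (Suc n)
  have w [measurable]: "(\<lambda>W. W [a]) \<in> borel_measurable word_clocks" if "a \<in> {1..d}" for a
    using that by (intro measurable_word_clock) (simp add: tree_vertices_def)
  have e [measurable]: "Measurable.pred word_clocks (\<lambda>W. effective d (\<lambda>y. W (a # y)))" if "a \<in> {1..d}" for a
    using pred_effective[OF measurable_subtree_clocks[OF that]] .
  have [measurable]: "(\<lambda>W. card {b \<in> {1..d}. effective d (\<lambda>y. W (b # y)) \<and> W [b] < W [a]})
      \<in> measurable word_clocks (count_space UNIV)" if a: "a \<in> {1..d}" for a
    using a by (intro measurable_card_filter) measurable
  have [measurable]: "Measurable.pred word_clocks (\<lambda>W. lineage d t n (\<lambda>y. W (a # y)))" if "a \<in> {1..d}" for a
    using measurable_compose[OF measurable_subtree_clocks[OF that] Suc] .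
  show ?case unfolding lineage.simps by (intro pred_intros_finite) measurable
qed simp

lemma pred_avail_at [measurable]: "Measurable.pred word_clocks (avail d s)"
  by (rule pred_avail) simp_all

lemma pred_effective_root [measurable]: "Measurable.pred word_clocks (effective d)"
  by (rule pred_effective) simp

lemma measurable_root_clock [measurable]: "(\<lambda>W. W []) \<in> borel_measurable word_clocks"
  by (rule measurable_word_clock[OF Nil_in_tree_vertices])

text \<open>Condition on the root clock: given its value \<open>u\<close>, effectiveness is
  availability at time \<open>u\<close>, and neither that nor \<open>R\<close> depends on the root
  clock.\<close>

lemma emeasure_root_clock:
  assumes B [measurable]: "B \<in> sets borel" and R [measurable]: "Measurable.pred word_clocks R"
    and inv: "\<And>W u. R (W([] := u)) = R W"
  shows "emeasure word_clocks {W \<in> space word_clocks. effective d W \<and> R W \<and> W [] \<in> B} =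
    (\<integral>\<^sup>+u. indicator B u * emeasure word_clocks {W \<in> space word_clocks. avail d u W \<and> R W} \<partial>unit_clock)"
proof -
  let ?M = "word_clocks"
  let ?S = "{W \<in> space ?M. effective d W \<and> R W \<and> W [] \<in> B}"
  let ?f = "\<lambda>p. (snd p)([] := fst p)"
  have S: "?S \<in> sets ?M" by measurable
  have f: "?f \<in> measurable (unit_clock \<Otimes>\<^sub>M ?M) ?M" by (rule measurable_resample_root)
  have "emeasure ?M ?S = emeasure (distr (unit_clock \<Otimes>\<^sub>M ?M) ?M ?f) ?S"
    using distr_resample_root by (simp add: case_prod_beta')
  also have "\<dots> = emeasure (unit_clock \<Otimes>\<^sub>M ?M) (?f -` ?S \<inter> space (unit_clock \<Otimes>\<^sub>M ?M))"
    using f S by (rule emeasure_distr)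
  also have "\<dots> = (\<integral>\<^sup>+u. emeasure ?M (Pair u -` (?f -` ?S \<inter> space (unit_clock \<Otimes>\<^sub>M ?M))) \<partial>unit_clock)"
    using f S by (intro word_clocks.emeasure_pair_measure_alt measurable_sets)
  also have "\<dots> = (\<integral>\<^sup>+u. indicator B u * emeasure ?M {W \<in> space ?M. avail d u W \<and> R W} \<partial>unit_clock)"
  proof (intro nn_integral_cong)
    fix u assume u: "u \<in> space unit_clock"
    have "W([] := u) \<in> space ?M" if "W \<in> space ?M" for W
      using measurable_space[OF f, of "(u, W)"] u that by (simp add: space_pair_measure)
    then have "Pair u -` (?f -` ?S \<inter> space (unit_clock \<Otimes>\<^sub>M ?M)) =
        (if u \<in> B then {W \<in> space ?M. avail d u W \<and> R W} else {})"
      using u by (auto simp: space_pair_measure effective_def avail_root_clock inv)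
    then show "emeasure ?M (Pair u -` (?f -` ?S \<inter> space (unit_clock \<Otimes>\<^sub>M ?M))) =
        indicator B u * emeasure ?M {W \<in> space ?M. avail d u W \<and> R W}"
      by simp
  qed
  finally show ?thesis .
qed

text \<open>Integrating the bound at fixed times over the root clock gives the hypothesis
  \<open>thin\<close> of \<open>survival_step\<close>.\<close>

lemma prob_effective_thinning:
  assumes R [measurable]: "Measurable.pred word_clocks R"
    and inv: "\<And>W u. R (W([] := u)) = R W" and "\<delta> \<ge> 0"
    and thin: "\<And>s. 0 \<le> s \<Longrightarrow> s \<le> t \<Longrightarrow> \<delta> * word_clocks.prob {W \<in> space word_clocks. avail d s W} \<le>
      word_clocks.prob {W \<in> space word_clocks. avail d s W \<and> R W}"
    and B [measurable]: "B \<in> sets borel"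
  shows "\<delta> * word_clocks.prob {W \<in> space word_clocks. effective d W \<and> W [] < t \<and> W [] \<in> B} \<le>
    word_clocks.prob {W \<in> space word_clocks. effective d W \<and> R W \<and> W [] < t \<and> W [] \<in> B}"
proof -
  let ?M = "word_clocks" and ?B = "{..<t} \<inter> B"
  have [measurable]: "?B \<in> sets borel" by measurable
  have meas: "(\<lambda>u. indicator ?B u * emeasure ?M {W \<in> space ?M. avail d u W}) \<in> borel_measurable unit_clock"
  proof -
    have [measurable]: "(\<lambda>u. u) \<in> borel_measurable unit_clock"
      by (intro measurable_restrict_space1) simp
    have [measurable]: "Measurable.pred (unit_clock \<Otimes>\<^sub>M ?M) (\<lambda>p. avail d (fst p) (snd p))"
      by (intro pred_avail) measurable
    show ?thesis by measurable
  qed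
  have "ennreal \<delta> * emeasure ?M {W \<in> space ?M. effective d W \<and> True \<and> W [] \<in> ?B} =
      (\<integral>\<^sup>+u. ennreal \<delta> * (indicator ?B u * emeasure ?M {W \<in> space ?M. avail d u W}) \<partial>unit_clock)"
    by (subst emeasure_root_clock) (simp_all add: nn_integral_cmult[OF meas])
  also have "\<dots> \<le> (\<integral>\<^sup>+u. indicator ?B u * emeasure ?M {W \<in> space ?M. avail d u W \<and> R W} \<partial>unit_clock)"
  proof (intro nn_integral_mono)
    fix u assume "u \<in> space unit_clock"
    then have "0 \<le> u" by (simp add: space_restrict_space)
    then show "ennreal \<delta> * (indicator ?B u * emeasure ?M {W \<in> space ?M. avail d u W}) \<le>
        indicator ?B u * emeasure ?M {W \<in> space ?M. avail d u W \<and> R W}"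
      using thin[of u] \<open>\<delta> \<ge> 0\<close>
      by (auto simp: indicator_def word_clocks.emeasure_eq_measure ennreal_mult[symmetric])
  qed
  also have "\<dots> = emeasure ?M {W \<in> space ?M. effective d W \<and> R W \<and> W [] \<in> ?B}"
    by (subst emeasure_root_clock) (simp_all add: inv)
  finally show ?thesis
    using \<open>\<delta> \<ge> 0\<close> by (simp add: word_clocks.emeasure_eq_measure ennreal_mult[symmetric])
qed

section \<open>Bounds on the probability of being effective\<close>

lemma AE_avail_iff:
  "AE W in word_clocks. avail d s W \<longleftrightarrow> card {a \<in> {1..d}. effective d (\<lambda>y. W (a # y)) \<and> W [a] < s} \<le> 2"
  using AE_wf_earlier_edge_clocks
proof eventually_elim
  case (elim W)
  show ?case
    using avail_subtree_iff[OF elim Nil_in_tree_vertices, of s] by (simp add: conj_commute)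
qed

text \<open>The function \<open>Q\<close> of the introductory outline.\<close>

definition effective_prob :: "real \<Rightarrow> real" where
  "effective_prob s = word_clocks.prob {W \<in> space word_clocks. effective d W \<and> W [] < s}"

lemma effective_prob_child:
  assumes a: "a \<in> {1..d}"
  shows "word_clocks.prob {W \<in> space word_clocks. effective d (\<lambda>y. W (a # y)) \<and> W [a] < s} = effective_prob s"
proof -
  let ?M = "word_clocks" and ?f = "\<lambda>W. \<lambda>y\<in>tree_vertices d. W (a # y)"
  let ?S = "{W \<in> space ?M. effective d W \<and> W [] < s}"
  have S: "?S \<in> sets ?M" by measurable
  note f = measurable_restrict_subtree_clocks[OF a]
  have "effective_prob s = measure (distr ?M ?M ?f) ?S"
    unfolding effective_prob_def distr_restrict_subtree_clocks[OF a] ..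
  also have "\<dots> = word_clocks.prob (?f -` ?S \<inter> space ?M)"
    using f S by (rule measure_distr)
  also have "?f -` ?S \<inter> space ?M = {W \<in> space ?M. effective d (\<lambda>y. W (a # y)) \<and> W [a] < s}"
    using restrict_subtree_clocks[of _ a] a measurable_space[OF f] Nil_in_tree_vertices[of d] by auto
  finally show ?thesis by simp
qed

text \<open>Markov's inequality: unavailability almost surely means at least three effective
  children before \<open>s\<close>, and their mean number is
  \<open>d * effective_prob s\<close>.\<close>

lemma avail_prob_ge: "1 - real d * effective_prob s / 3 \<le> word_clocks.prob {W \<in> space word_clocks. avail d s W}"
proof -
  let ?M = "word_clocks"
  let ?E = "\<lambda>a. {W \<in> space ?M. effective d (\<lambda>y. W (a # y)) \<and> W [a] < s}"
  have E: "?E a \<in> sets ?M" if a: "a \<in> {1..d}" for a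
  proof -
    have [measurable]: "[a] \<in> tree_vertices d" "a \<in> {1..d}" using a by (simp_all add: tree_vertices_def)
    have [measurable]: "Measurable.pred ?M (\<lambda>W. effective d (\<lambda>y. W (a # y)))" by (intro pred_effective) measurable
    show ?thesis by measurable
  qed
  let ?X = "{W \<in> space ?M. \<not> avail d s W}"
  have X: "?X \<in> sets ?M" by measurable
  have "3 * word_clocks.prob ?X = (\<integral>W. 3 * indicator ?X W \<partial>?M)"
    using X by simp
  also have "\<dots> \<le> (\<integral>W. (\<Sum>a\<in>{1..d}. indicator (?E a) W) \<partial>?M)"
  proof (rule integral_mono_AE)
    show "AE W in ?M. 3 * indicator ?X W \<le> (\<Sum>a\<in>{1..d}. indicator (?E a) W :: real)"
      using AE_avail_iff[of s] AE_space
    proof eventually_elim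
      case (elim W)
      have "(\<Sum>a\<in>{1..d}. indicator (?E a) W :: real) =
          (\<Sum>a\<in>{1..d}. if effective d (\<lambda>y. W (a # y)) \<and> W [a] < s then 1 else 0)"
        using elim(2) by (intro sum.cong) (auto simp: indicator_def)
      also have "\<dots> = card {a \<in> {1..d}. effective d (\<lambda>y. W (a # y)) \<and> W [a] < s}"
        by (simp add: sum.If_cases Int_def)
      finally show ?case using elim(1) by (auto simp: indicator_def)
    qed
  qed (use E X in \<open>auto intro!: Bochner_Integration.integrable_sum integrable_real_indicator
        Bochner_Integration.integrable_mult_right simp: word_clocks.emeasure_eq_measure\<close>)
  also have "\<dots> = (\<Sum>a\<in>{1..d}. word_clocks.prob (?E a))"
    using E by (subst Bochner_Integration.integral_sum) (auto simp: word_clocks.emeasure_eq_measure)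
  also have "\<dots> = real d * effective_prob s"
    using effective_prob_child by simp
  finally have "3 * word_clocks.prob ?X \<le> real d * effective_prob s" .
  moreover have "word_clocks.prob ?X = 1 - word_clocks.prob {W \<in> space ?M. avail d s W}"
    by (rule word_clocks.prob_neg) measurable
  ultimately show ?thesis by simp
qed

lemma effective_prob_mono: "r \<le> s \<Longrightarrow> effective_prob r \<le> effective_prob s"
  unfolding effective_prob_def by (intro word_clocks.finite_measure_mono) auto

text \<open>Condition on the root clock \<open>u < s\<close>; by monotonicity the Markov bound at
  \<open>u\<close> is no worse than the one at \<open>s\<close>.\<close>

lemma effective_prob_ge:
  assumes s: "0 \<le> s" "s \<le> 1"
  shows "s * (1 - real d * effective_prob s / 3) \<le> effective_prob s"
proof -
  let ?M = "word_clocks" and ?c = "1 - real d * effective_prob s / 3"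
  have "ennreal s = emeasure unit_clock {0..<s}"
    using s by (subst emeasure_restrict_space) auto
  \<comment> \<open>The constant \<open>?c\<close> may be negative; \<open>ennreal\<close> then
    truncates it to 0 and the estimate remains true.\<close>
  then have "ennreal (s * ?c) \<le> (\<integral>\<^sup>+u. ennreal ?c * indicator {0..<s} u \<partial>unit_clock)"
    using s by (subst nn_integral_cmult_indicator)
      (auto simp: sets_restrict_space_iff ennreal_mult' mult.commute)
  also have "\<dots> \<le> (\<integral>\<^sup>+u. indicator {..<s} u * emeasure ?M {W \<in> space ?M. avail d u W \<and> True} \<partial>unit_clock)"
  proof (intro nn_integral_mono)
    fix u
    have "?c \<le> word_clocks.prob {W \<in> space ?M. avail d u W}" if "u < s"
    proof -
      have "real d * effective_prob u \<le> real d * effective_prob s"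
        using that by (intro mult_left_mono effective_prob_mono) auto
      then show ?thesis using avail_prob_ge[of u] by simp
    qed
    then show "ennreal ?c * indicator {0..<s} u \<le>
        indicator {..<s} u * emeasure ?M {W \<in> space ?M. avail d u W \<and> True}"
      by (auto simp: indicator_def word_clocks.emeasure_eq_measure intro: ennreal_leI)
  qed
  also have "\<dots> = emeasure ?M {W \<in> space ?M. effective d W \<and> True \<and> W [] \<in> {..<s}}"
    by (subst emeasure_root_clock) simp_all
  also have "\<dots> = ennreal (effective_prob s)"
    by (simp add: effective_prob_def word_clocks.emeasure_eq_measure)
  finally show ?thesis by (simp add: effective_prob_def)
qed

text \<open>Solving the preceding inequality gives \<open>p \<ge> 3 * t / (3 + d * t)\<close>, which
  for \<open>t > 3 / 4\<close> exceeds \<open>1 / (1 + d / 2)\<close>; that is,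
  \<open>1 - p < (d / 2) * p\<close>.\<close>

lemma effective_prob_supercritical:
  assumes d: "d \<ge> 2" and t: "3 / 4 < t" "t \<le> 1"
  shows "(1 - effective_prob t)\<^sup>2 < real (d choose 2) * (effective_prob t)\<^sup>2"
proof -
  define p where "p = effective_prob t"
  have p: "p \<le> 1" "t * (1 - d * p / 3) \<le> p"
    using effective_prob_ge[of t] t by (simp_all add: p_def effective_prob_def)
  from p(2) have "3 * t \<le> p * (3 + d * t)" by (simp add: field_simps)
  \<comment> \<open>This amounts to \<open>3 < 3 * t + d * t / 2\<close>. As
    \<open>d \<ge> 2\<close>, it follows from \<open>3 < 4 * t\<close>, the origin of the threshold
    3/4.\<close>
  moreover have "3 + real d * t < (3 * t) * (1 + d / 2)"
  proof -
    have "2 * t \<le> real d * t" using d t by (intro mult_right_mono) auto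
    moreover have "(3 * t) * (1 + d / 2) = 3 * t + 3 * (real d * t) / 2" by (simp add: field_simps)
    ultimately show ?thesis using t by linarith
  qed
  ultimately have "3 + real d * t < p * (3 + d * t) * (1 + d / 2)"
    by (smt (verit, best) mult_right_mono divide_nonneg_nonneg of_nat_0_le_iff)
  then have "(3 + real d * t) * 1 < (3 + real d * t) * (p * (1 + d / 2))" by (simp add: mult_ac)
  moreover have "0 < 3 + real d * t" using t by (simp add: add_pos_nonneg)
  ultimately have "1 < p * (1 + d / 2)" using mult_less_cancel_left_pos by blast
  then have "1 - p < (d / 2) * p" by (simp add: field_simps)
  then have "(1 - p)\<^sup>2 < ((d / 2) * p)\<^sup>2" using p(1) by (intro power_strict_mono) auto
  also have "\<dots> = (d / 2)\<^sup>2 * p\<^sup>2" by (rule power_mult_distrib)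
  \<comment> \<open>For \<open>d \<ge> 2\<close> the binomial coefficient is at least
    \<open>(d / 2)\<^sup>2\<close>, with equality at \<open>d = 2\<close>.\<close>
  also have "\<dots> \<le> real (d choose 2) * p\<^sup>2"
  proof (rule mult_right_mono)
    have "real (d choose 2) = (real d * real d - real d) / 2"
      unfolding choose_two using d by (subst real_of_nat_div) (auto simp: of_nat_diff right_diff_distrib)
    moreover have "real d * 2 \<le> real d * real d" using d by (intro mult_left_mono) auto
    moreover have "x \<le> 4 * c" if "c = (x - y) / 2" "y * 2 \<le> x" for c x y :: real
      using that by (simp add: field_simps)
    ultimately have "real d * real d \<le> 4 * real (d choose 2)" by blast
    then show "(real d / 2)\<^sup>2 \<le> real (d choose 2)" by (simp add: power2_eq_square)
  qed simp
  finally show ?thesis unfolding p_def .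
qed

section \<open>Survival through all generations\<close>

lemma measure_children_eq:
  assumes "d > 0" and P: "Measurable.pred (\<Pi>\<^sub>M a\<in>{1..d}. word_clocks) P"
  shows "measure (\<Pi>\<^sub>M a\<in>{1..d}. word_clocks) {z \<in> space (\<Pi>\<^sub>M a\<in>{1..d}. word_clocks). P z} =
    word_clocks.prob {W \<in> space word_clocks. P (\<lambda>a\<in>{1..d}. \<lambda>y. W (a # y))}"
proof -
  let ?M = "word_clocks" and ?P = "\<Pi>\<^sub>M a\<in>{1..d}. word_clocks"
  let ?f = "\<lambda>W. \<lambda>a\<in>{1..d}. \<lambda>y. W (a # y)"
  have f: "?f \<in> measurable ?M ?P"
    by (intro measurable_restrict measurable_subtree_clocks)
  have "measure ?P {z \<in> space ?P. P z} = measure (distr ?M ?P ?f) {z \<in> space ?P. P z}"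
    unfolding distr_subtree_clocks[OF assms(1)] ..
  also have "\<dots> = word_clocks.prob (?f -` {z \<in> space ?P. P z} \<inter> space ?M)"
    using f P by (intro measure_distr) (auto simp: pred_def)
  also have "?f -` {z \<in> space ?P. P z} \<inter> space ?M = {W \<in> space ?M. P (?f W)}"
    using measurable_space[OF f] by auto
  finally show ?thesis .
qed

text \<open>Induction on the generations with \<open>s\<close> generalised: an effective child with
  clock \<open>u\<close> is one available at time \<open>u\<close>, so the hypothesis is needed for
  all \<open>u < t\<close>. Since \<open>survival_step\<close> reproduces the same \<delta>, no loss
  accumulates.\<close>

lemma lineage_prob_ge:
  assumes d: "d \<ge> 2" and \<delta>: "0 \<le> \<delta>" "\<delta> \<le> 1"
    and super: "(1 - effective_prob t)\<^sup>2 \<le> (1 - \<delta>) * (real (d choose 2) * (effective_prob t)\<^sup>2)"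
  shows "s \<le> t \<Longrightarrow> \<delta> * word_clocks.prob {W \<in> space word_clocks. avail d s W} \<le>
    word_clocks.prob {W \<in> space word_clocks. avail d s W \<and> lineage d t n W}"
proof (induction n arbitrary: s)
  case 0
  then show ?case using \<delta> by (simp add: mult_left_le_one_le)
next
  case (Suc n)
  let ?M = "word_clocks" and ?P = "\<Pi>\<^sub>M a\<in>{1..d}. word_clocks"
  let ?F = "{W \<in> space ?M. effective d W}" and ?H = "{W \<in> space ?M. lineage d t n W}"
  let ?Z = "\<lambda>W. \<lambda>a\<in>{1..d}. \<lambda>y. W (a # y)"
  let ?few = "\<lambda>z. card {a \<in> {1..d}. z a \<in> ?F \<and> z a [] < s} \<le> 2"
  let ?good = "\<lambda>z. \<exists>a\<in>{1..d}. z a \<in> ?F \<and> z a \<in> ?H \<and> z a [] < t \<and>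
    card {b \<in> {1..d}. z b \<in> ?F \<and> z b [] < z a []} \<le> 1"
  note pred_lineage [measurable]
  have FH: "?F \<in> sets ?M" "?H \<in> sets ?M" by measurable
  have step: "\<delta> * measure ?P {z \<in> space ?P. ?few z} \<le> measure ?P {z \<in> space ?P. ?few z \<and> ?good z}"
  proof (rule word_clocks.survival_step[where p = "effective_prob t"])
    fix B :: "real set" assume B: "B \<in> sets borel"
    have "\<delta> * word_clocks.prob {W \<in> space ?M. effective d W \<and> W [] < t \<and> W [] \<in> B} \<le>
        word_clocks.prob {W \<in> space ?M. effective d W \<and> lineage d t n W \<and> W [] < t \<and> W [] \<in> B}"
      by (rule prob_effective_thinning) (use Suc.IH \<delta> B in \<open>auto simp: lineage_root_clock\<close>)
    then show "\<delta> * word_clocks.prob {w \<in> space ?M. w \<in> ?F \<and> w [] < t \<and> w [] \<in> B} \<le>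
        word_clocks.prob {w \<in> space ?M. w \<in> ?F \<and> w \<in> ?H \<and> w [] < t \<and> w [] \<in> B}"
      by (simp add: conj_ac cong: conj_cong)
  next
    show "effective_prob t = word_clocks.prob {w \<in> space ?M. w \<in> ?F \<and> w [] < t}"
      unfolding effective_prob_def by (simp cong: conj_cong)
  qed (use d \<delta> super Suc.prems FH in auto)
  have comp [measurable]: "(\<lambda>z. z a) \<in> measurable ?P ?M" if "a \<in> {1..d}" for a
    using that by (intro measurable_component_singleton)
  note FH [measurable]
  have few_pred: "Measurable.pred ?P ?few"
  proof -
    have [measurable]: "(\<lambda>z. card {a \<in> {1..d}. z a \<in> ?F \<and> z a [] < s}) \<in> measurable ?P (count_space UNIV)"
      by (intro measurable_card_filter) measurable
    show ?thesis by measurable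
  qed
  have good_pred: "Measurable.pred ?P ?good"
  proof -
    have [measurable]: "(\<lambda>z. card {b \<in> {1..d}. z b \<in> ?F \<and> z b [] < z a []}) \<in> measurable ?P (count_space UNIV)"
      if "a \<in> {1..d}" for a
      using that by (intro measurable_card_filter) measurable
    show ?thesis by (intro pred_intros_finite(4)) measurable
  qed
  have Z: "?Z W a \<in> space ?M" if "W \<in> space ?M" "a \<in> {1..d}" for W a
    using measurable_space[OF measurable_subtree_clocks[OF that(2)] that(1)] that(2) by simp
  have few: "?few (?Z W) \<longleftrightarrow> card {a \<in> {1..d}. effective d (\<lambda>y. W (a # y)) \<and> W [a] < s} \<le> 2"
    if "W \<in> space ?M" for W
    using Z[OF that] by (simp cong: conj_cong)
  have good: "?good (?Z W) \<longleftrightarrow> lineage d t (Suc n) W" if "W \<in> space ?M" for W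
    using Z[OF that] by (auto cong: conj_cong)
  have few_AE: "AE W in ?M. ?few (?Z W) \<longleftrightarrow> avail d s W"
    using AE_avail_iff[of s] AE_space by eventually_elim (simp only: few)
  have "d > 0" using d by simp
  have Zm: "?Z \<in> measurable ?M ?P"
    by (intro measurable_restrict measurable_subtree_clocks)
  have fewM: "{W \<in> space ?M. ?few (?Z W)} \<in> sets ?M"
    using measurable_compose[OF Zm few_pred] unfolding pred_def .
  have goodM: "{W \<in> space ?M. ?few (?Z W) \<and> ?good (?Z W)} \<in> sets ?M"
    using pred_intros_logic(3)[OF measurable_compose[OF Zm few_pred] measurable_compose[OF Zm good_pred]]
    unfolding pred_def .
  have "word_clocks.prob {W \<in> space ?M. avail d s W} = word_clocks.prob {W \<in> space ?M. ?few (?Z W)}"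
  proof (rule word_clocks.finite_measure_eq_AE[OF _ _ fewM])
    show "AE W in ?M. (W \<in> {W \<in> space ?M. avail d s W}) = (W \<in> {W \<in> space ?M. ?few (?Z W)})"
      using few_AE by eventually_elim blast
    show "{W \<in> space ?M. avail d s W} \<in> sets ?M" by measurable
  qed
  moreover have "word_clocks.prob {W \<in> space ?M. avail d s W \<and> lineage d t (Suc n) W} =
      word_clocks.prob {W \<in> space ?M. ?few (?Z W) \<and> ?good (?Z W)}"
  proof (rule word_clocks.finite_measure_eq_AE[OF _ _ goodM])
    show "AE W in ?M. (W \<in> {W \<in> space ?M. avail d s W \<and> lineage d t (Suc n) W}) =
        (W \<in> {W \<in> space ?M. ?few (?Z W) \<and> ?good (?Z W)})"
      using few_AE by eventually_elim (use good in blast)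
    show "{W \<in> space ?M. avail d s W \<and> lineage d t (Suc n) W} \<in> sets ?M" by measurable
  qed
  ultimately show ?case
    using step unfolding measure_children_eq[OF \<open>d > 0\<close> few_pred]
      measure_children_eq[OF \<open>d > 0\<close> pred_intros_logic(3)[OF few_pred good_pred]] by (simp only:)
qed

text \<open>The uniform bound is used at time 0, when availability has probability 1 because no
  clock is negative. It passes to the limit of the decreasing survival events.\<close>

lemma lineage_forever_prob_pos:
  assumes d: "d \<ge> 2" and t: "3 / 4 < t" "t \<le> 1"
  shows "0 < word_clocks.prob {W \<in> space word_clocks. \<forall>n. lineage d t n W}"
proof -
  let ?M = "word_clocks"
  define p where "p = effective_prob t"
  define c where "c = real (d choose 2) * p\<^sup>2"
  \<comment> \<open>This choice gives equality in the condition on \<delta> of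
    \<open>lineage_prob_ge\<close>; strict supercriticality makes it positive.\<close>
  define \<delta> where "\<delta> = 1 - (1 - p)\<^sup>2 / c"
  have super: "(1 - p)\<^sup>2 < c"
    using effective_prob_supercritical[OF d t] by (simp add: p_def c_def)
  then have c: "0 < c" by (meson le_less_trans zero_le_power2)
  with super have \<delta>: "0 < \<delta>" "\<delta> \<le> 1" by (simp_all add: \<delta>_def)
  have "(1 - p)\<^sup>2 \<le> (1 - \<delta>) * c" using c by (simp add: \<delta>_def)
  then have ge: "\<delta> * word_clocks.prob {W \<in> space ?M. avail d 0 W} \<le>
      word_clocks.prob {W \<in> space ?M. avail d 0 W \<and> lineage d t n W}" for n
    using lineage_prob_ge[OF d, of \<delta> t 0 n] \<delta> t by (simp add: p_def c_def)
  note pred_lineage [measurable]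
  let ?A = "\<lambda>n. {W \<in> space ?M. lineage d t n W}"
  have "effective_prob 0 = 0"
  proof -
    have "{W \<in> space ?M. effective d W \<and> W [] < 0} = {}"
      using clock_in_unit_interval[of _ "[]"] Nil_in_tree_vertices[of d] by fastforce
    then show ?thesis unfolding effective_prob_def by (simp only: measure_empty)
  qed
  then have "1 \<le> word_clocks.prob {W \<in> space ?M. avail d 0 W}"
    using avail_prob_ge[of 0] by simp
  then have "\<delta> * 1 \<le> \<delta> * word_clocks.prob {W \<in> space ?M. avail d 0 W}"
    using \<delta> by (intro mult_left_mono) auto
  also note ge
  also have "word_clocks.prob {W \<in> space ?M. avail d 0 W \<and> lineage d t n W} \<le> word_clocks.prob (?A n)" for n
    by (intro word_clocks.finite_measure_mono) auto
  finally have "\<delta> \<le> word_clocks.prob (?A n)" for n by simp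
  moreover have "(\<lambda>n. word_clocks.prob (?A n)) \<longlonglongrightarrow> word_clocks.prob (\<Inter>n. ?A n)"
  proof (rule word_clocks.finite_Lim_measure_decseq)
    show "decseq ?A" by (rule decseq_SucI) (use lineage_Suc in blast)
  qed auto
  ultimately have "\<delta> \<le> word_clocks.prob (\<Inter>n. ?A n)"
    by (intro LIMSEQ_le_const) auto
  also have "(\<Inter>n. ?A n) = {W \<in> space ?M. \<forall>n. lineage d t n W}" by auto
  finally show ?thesis using \<delta> by simp
qed

section \<open>The percolation probability of the tree\<close>

lemma percolation_prob_tree_eq:
  assumes "t \<in> {0..1}"
  shows "percolation_prob (tree_vertices d) (tree_edges d) [] k t = measure (clock_measure (tree_edges d))
    {U \<in> space (clock_measure (tree_edges d)). infinite (open_cluster (tree_vertices d)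
      {e \<in> tree_edges d. U e < t \<and> opens (tree_vertices d) (tree_edges d) k U e} [])}"
  using tree_edges_degree(1) AE_wf_earlier_tree assms by (rule percolation_prob_eq)

text \<open>Provides an element of the set whose supremum is the critical time.\<close>

lemma percolation_prob_tree_0: "percolation_prob (tree_vertices d) (tree_edges d) [] k 0 = 0"
proof -
  let ?M = "clock_measure (tree_edges d)"
  have "finite (open_cluster (tree_vertices d)
      {e \<in> tree_edges d. U e < 0 \<and> opens (tree_vertices d) (tree_edges d) k U e} [])"
    if "U \<in> space ?M" for U
  proof -
    have "\<not> U e < 0" if "e \<in> tree_edges d" for e
      using \<open>U \<in> space ?M\<close> that by (force simp: clock_measure_def space_PiM space_restrict_space PiE_iff)
    then have none: "{e \<in> tree_edges d. U e < 0 \<and> opens (tree_vertices d) (tree_edges d) k U e} = {}" by blast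
    have "open_cluster (tree_vertices d)
      {e \<in> tree_edges d. U e < 0 \<and> opens (tree_vertices d) (tree_edges d) k U e} [] \<subseteq> {[]}"
      unfolding none by (auto simp: open_cluster_def)
    then show ?thesis by (rule finite_subset) simp
  qed
  then have "{U \<in> space ?M. infinite (open_cluster (tree_vertices d)
      {e \<in> tree_edges d. U e < 0 \<and> opens (tree_vertices d) (tree_edges d) k U e} [])} = {}" by blast
  moreover have "0 \<in> {0..1::real}" by simp
  ultimately show ?thesis by (simp only: percolation_prob_tree_eq measure_empty)
qed

text \<open>Endless lineages almost surely force an infinite cluster for the edge clocks, and
  \<open>edge_clocks\<close> carries the law of word clocks to that of the model.\<close>

lemma percolation_prob_tree_pos:
  assumes d: "d \<ge> 2" and t: "3 / 4 < t" "t \<le> 1"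
  shows "0 < percolation_prob (tree_vertices d) (tree_edges d) [] (\<lambda>_. 3) t"
proof -
  let ?M = "clock_measure (tree_edges d)" and ?V = "tree_vertices d" and ?E = "tree_edges d"
  let ?Q = "\<lambda>U. infinite (open_cluster ?V {e \<in> ?E. U e < t \<and> opens ?V ?E (\<lambda>_. 3) U e} [])"
  note [measurable] = pred_infinite_open_cluster[where E = ?E and V = ?V and t = t and k = "\<lambda>_. 3" and x = "[]"] distr_edge_clocks(1)
  note pred_lineage [measurable]
  have "0 < word_clocks.prob {W \<in> space word_clocks. \<forall>n. lineage d t n W}"
    by (rule lineage_forever_prob_pos[OF assms])
  also have "\<dots> \<le> word_clocks.prob {W \<in> space word_clocks. ?Q (edge_clocks d W)}"
  proof (rule word_clocks.finite_measure_mono_AE)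
    show "AE W in word_clocks. W \<in> {W \<in> space word_clocks. \<forall>n. lineage d t n W} \<longrightarrow>
        W \<in> {W \<in> space word_clocks. ?Q (edge_clocks d W)}"
      using AE_wf_earlier_edge_clocks
      by eventually_elim (use infinite_open_cluster_if_lineage in blast)
    show "{W \<in> space word_clocks. ?Q (edge_clocks d W)} \<in> word_clocks.events" by measurable
  qed
  also have "\<dots> = measure (distr word_clocks ?M (edge_clocks d)) {U \<in> space ?M. ?Q U}"
  proof (subst measure_distr[OF distr_edge_clocks(1)])
    show "{U \<in> space ?M. ?Q U} \<in> sets ?M" by measurable
    have "edge_clocks d -` {U \<in> space ?M. ?Q U} \<inter> space word_clocks =
        {W \<in> space word_clocks. ?Q (edge_clocks d W)}"
      using measurable_space[OF distr_edge_clocks(1)] by auto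
    then show "word_clocks.prob {W \<in> space word_clocks. ?Q (edge_clocks d W)} =
        word_clocks.prob (edge_clocks d -` {U \<in> space ?M. ?Q U} \<inter> space word_clocks)" by simp
  qed
  also have "\<dots> = percolation_prob ?V ?E [] (\<lambda>_. 3) t"
    using t by (simp add: distr_edge_clocks(2) percolation_prob_tree_eq)
  finally show ?thesis .
qed

end

theorem theorem3:
  fixes d :: nat
  assumes "d \<ge> 2"
  shows "critical_time (tree_vertices d) (tree_edges d) [] (\<lambda>_. 3) < 1"
proof -
  let ?S = "{t \<in> {0..1}. percolation_prob (tree_vertices d) (tree_edges d) [] (\<lambda>_. 3) t = 0}"
  \<comment> \<open>Percolation has positive probability at every time in \<open>(3/4, 1]\<close>,
    so the bound on the critical time is uniform in \<open>d\<close>.\<close>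
  have "Sup ?S \<le> 3 / 4"
  proof (rule cSup_least)
    show "?S \<noteq> {}" using percolation_prob_tree_0[of d "\<lambda>_. 3"] by force
    fix t assume "t \<in> ?S"
    then show "t \<le> 3 / 4" using percolation_prob_tree_pos[OF assms, of t] by fastforce
  qed
  then show ?thesis unfolding critical_time_def by simp
qed

end
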